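(* For every $\gamma>0$ there is $n_0$ such that for all $n\ge n_0$ the following holds. If $T$ is a tournament on $n$ vertices with $\mathrm{ex}(T)\ge 8n^{17/9+\gamma}$, then $T$ has a perfect decomposition.
   Context: A tournament is an orientation of a complete graph; paths are directed. For a digraph $D$, $\mathrm{ex}_D(v)=d^+_D(v)-d^-_D(v)$, $\mathrm{ex}^+_D(v)=\max\{\mathrm{ex}_D(v),0\}$, $\mathrm{ex}(D)=\sum_v\mathrm{ex}^+_D(v)$. A perfect decomposition of $D$ is a set of exactly $\mathrm{ex}(D)$ paths of $D$ whose edge sets partition $E(D)$. *)

theory Defs
  imports Complex_Main "HOL-Library.Disjoint_Sets" "Graph_Theory.Pair_Digraph"
begin

locale tournament = pair_digraph T for T :: "'a pair_pre_digraph" +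
  assumes exactly_one_orientation:
    "\<lbrakk>u \<in> pverts T; v \<in> pverts T; u \<noteq> v\<rbrakk> \<Longrightarrow> (u, v) \<in> parcs T \<longleftrightarrow> (v, u) \<notin> parcs T"

definition excess :: "'a pair_pre_digraph \<Rightarrow> 'a \<Rightarrow> int" where
  "excess D v = int (out_degree (with_proj D) v) - int (in_degree (with_proj D) v)"

definition pos_excess :: "'a pair_pre_digraph \<Rightarrow> 'a \<Rightarrow> int" where
  "pos_excess D v = max (excess D v) 0"

definition total_excess :: "'a pair_pre_digraph \<Rightarrow> int" where
  "total_excess D = (\<Sum>v\<in>pverts D. pos_excess D v)"

(* A path is given by its list of arcs. The blocks of a partition are nonempty, so every path
   has at least one arc. Disjointness is required for distinct members of P, not merely for
   distinct arc sets. *)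
definition perfect_decomposition :: "'a pair_pre_digraph \<Rightarrow> ('a \<times> 'a) awalk set \<Rightarrow> bool" where
  "perfect_decomposition D P \<longleftrightarrow>
     finite P \<and> int (card P) = total_excess D \<and>
     (\<forall>p\<in>P. p \<noteq> [] \<and> (\<exists>u v. pre_digraph.apath (with_proj D) u p v)) \<and>
     disjoint_family_on set P \<and> (\<Union>p\<in>P. set p) = parcs D"

end

theory Submission
  imports Defs "HOL-Real_Asymp.Real_Asymp"
begin

text \<open>A decomposition into paths has the minimum size as soon as no vertex is both a start and an end.
  Let \<open>s\<close> be of order \<open>n powr (8/9)\<close>. The excess forces at least \<open>3 * s\<close> vertices of excess at least
  \<open>s\<close>, and as many of excess at most \<open>- s\<close>; since about half of the arcs of any cut go either way, every
  vertex is joined to both kinds by paths of logarithmic length, even after deleting some arcs and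
  vertices. Hence one can set aside an arc-disjoint family of short absorbing paths from high to low
  excess, \<open>N\<close> of them through each vertex and disjoint apart from it. The remaining arcs split into
  paths of length at most about \<open>sqrt n\<close> such that at each vertex the number of starts or the number of ends
  is much smaller than \<open>N\<close>. An end of a path \<open>p\<close> and a start of a path \<open>q\<close> at the same vertex \<open>x\<close>
  are removed by cutting an absorbing path at \<open>x\<close>: \<open>p\<close> continues along its second half, and \<open>q\<close> is
  entered through its first half.\<close>

section \<open>Arcs and partitions into paths\<close>

text \<open>Cutting an absorbing path only moves a start and an end, to vertices of excess at least
  \<open>s\<close> and at most \<open>- s\<close>. This is harmless because fewer than
  \<open>s\<close> absorbing paths touch any vertex: so large an excess is not due to them alone,
  and the other paths at that vertex have a majority of the same sign. The exponents come from three
  balances, up to logarithms. There are at most \<open>n^2 / L\<close> arc-disjoint paths with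
  \<open>L\<close> arcs; holding the starts and ends at every vertex to order \<open>q\<close> takes
  \<open>L * q^2\<close> of order \<open>n^2\<close> for these paths and \<open>q^2\<close> of order
  \<open>L * n\<close> for the leftover cycles, so \<open>L = n^(1/2)\<close> and
  \<open>q = n^(3/4)\<close>. Next, \<open>N\<close> must exceed a multiple of \<open>q\<close>. The
  \<open>n * N\<close> absorbing paths must leave at most \<open>U\<close> vertices lying on
  \<open>U\<close> of them, so \<open>U\<close> is of order \<open>sqrt (n * N)\<close>, about
  \<open>n^(7/8)\<close>, and \<open>s\<close> must exceed \<open>2 * U\<close>. The exponent
  \<open>8/9\<close> is just above \<open>7/8\<close>, with room for logarithms and
  rounding.\<close>

text \<open>Paths are vertex lists throughout; the arc walks of the statement are recovered at the
  end as \<open>zip p (tl p)\<close>.\<close>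

definition path_arcs :: "'a list \<Rightarrow> ('a \<times> 'a) set" where
  "path_arcs p = set (zip p (tl p))"

lemma path_arcs_simps [simp]:
  "path_arcs [] = {}" "path_arcs [x] = {}"
  "path_arcs (x # y # p) = insert (x, y) (path_arcs (y # p))"
  by (auto simp: path_arcs_def)

lemma finite_path_arcs [simp]: "finite (path_arcs p)"
  by (simp add: path_arcs_def)

lemma path_arcs_append_hd:
  "p \<noteq> [] \<Longrightarrow> q \<noteq> [] \<Longrightarrow> path_arcs (p @ q) = insert (last p, hd q) (path_arcs p \<union> path_arcs q)"
proof (induction p)
  case (Cons a p)
  then show ?case by (cases p; cases q) auto
qed simp

lemma path_arcs_glue:
  assumes "p \<noteq> []" "q \<noteq> []" "last p = hd q"
  shows "path_arcs (p @ tl q) = path_arcs p \<union> path_arcs q"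
proof (cases "tl q")
  case Nil
  then show ?thesis using assms by (cases q) auto
next
  case (Cons b r)
  then have q: "q = last p # b # r" using assms by (cases q) auto
  then show ?thesis using assms(1) by (auto simp: path_arcs_append_hd)
qed

lemma path_arcs_glue':
  assumes "p \<noteq> []" "q \<noteq> []" "last p = hd q"
  shows "path_arcs (butlast p @ q) = path_arcs p \<union> path_arcs q"
proof -
  have "butlast p @ q = p @ tl q"
    using assms by (metis append.assoc append_Cons append_Nil append_butlast_last_id list.collapse)
  then show ?thesis using path_arcs_glue[OF assms] by simp
qed

lemma path_arcs_subset_set: "path_arcs p \<subseteq> set p \<times> set p"
  by (induction p rule: induct_list012) auto

lemma path_arcs_fst_butlast: "(u, v) \<in> path_arcs p \<Longrightarrow> u \<in> set (butlast p) \<and> v \<in> set (tl p)"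
  by (induction p rule: induct_list012) (auto split: if_splits)

lemma path_arcs_empty_iff: "path_arcs p = {} \<longleftrightarrow> length p \<le> 1"
  by (induction p rule: induct_list012) auto

lemma card_path_arcs: "distinct p \<Longrightarrow> card (path_arcs p) = length p - 1"
  unfolding path_arcs_def by (subst distinct_card) (auto intro: distinct_zipI1)

lemma path_arcs_rev: "path_arcs (rev p) = (path_arcs p)\<inverse>"
proof (induction p rule: induct_list012)
  case (3 x y zs)
  then show ?case using path_arcs_append_hd[of "rev zs @ [y]" "[x]"] by auto
qed auto

lemma path_arcs_out_unique: "distinct p \<Longrightarrow> (u, v) \<in> path_arcs p \<Longrightarrow> (u, w) \<in> path_arcs p \<Longrightarrow> v = w"
proof (induction p rule: induct_list012)
  case (3 x y zs)
  then show ?case using path_arcs_subset_set[of "y # zs"] by auto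
qed auto

lemma path_arcs_in_unique: "distinct p \<Longrightarrow> (v, u) \<in> path_arcs p \<Longrightarrow> (w, u) \<in> path_arcs p \<Longrightarrow> v = w"
  using path_arcs_out_unique[of "rev p" u v w] by (auto simp: path_arcs_rev)

lemma path_arcs_append_subset: "path_arcs p \<subseteq> path_arcs (p @ q)" "path_arcs q \<subseteq> path_arcs (p @ q)"
  by (cases "p = []"; cases "q = []"; auto simp: path_arcs_append_hd)+

lemma path_arcs_take_subset: "path_arcs (take k p) \<subseteq> path_arcs p"
  using path_arcs_append_subset(1)[of "take k p" "drop k p"] by simp

lemma path_arcs_tl_subset: "path_arcs (tl p) \<subseteq> path_arcs p"
  by (induction p rule: induct_list012) auto

lemma path_arcs_butlast_subset: "path_arcs (butlast p) \<subseteq> path_arcs p"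
  by (simp add: butlast_conv_take path_arcs_take_subset)

section \<open>Excess of an arc set, and partitions into paths\<close>

text \<open>A single sum over arcs adds up over the blocks of a partition and can be exchanged with
  sums over vertices; \<open>arc_excess_degrees\<close> recovers the difference of the
  degrees.\<close>

definition arc_excess :: "('a \<times> 'a) set \<Rightarrow> 'a \<Rightarrow> int" where
  "arc_excess E v = (\<Sum>e\<in>E. of_bool (fst e = v) - of_bool (snd e = v))"

lemma arc_excess_Un:
  "finite E \<Longrightarrow> finite F \<Longrightarrow> E \<inter> F = {} \<Longrightarrow> arc_excess (E \<union> F) v = arc_excess E v + arc_excess F v"
  by (simp add: arc_excess_def sum.union_disjoint)

lemma arc_excess_path:
  assumes "distinct p" "p \<noteq> []"
  shows "arc_excess (path_arcs p) v = of_bool (hd p = v) - of_bool (last p = v)"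
  using assms
proof (induction p rule: induct_list012)
  case (3 x y zs)
  have "(x, y) \<notin> path_arcs (y # zs)"
    using 3(3) path_arcs_subset_set[of "y # zs"] by auto
  then show ?case using 3 by (simp add: arc_excess_def)
qed (auto simp: arc_excess_def)

definition starts :: "'a list set \<Rightarrow> 'a \<Rightarrow> nat" where
  "starts S v = card {p \<in> S. hd p = v}"

definition ends :: "'a list set \<Rightarrow> 'a \<Rightarrow> nat" where
  "ends S v = card {p \<in> S. last p = v}"

text \<open>Length at least 2 gives every path an arc and a start different from its end, and keeps
  distinct members from sharing an empty arc set.\<close>

definition path_partition :: "('a \<times> 'a) set \<Rightarrow> 'a list set \<Rightarrow> bool" where
  "path_partition E S \<longleftrightarrow> finite S \<and> (\<forall>p\<in>S. distinct p \<and> 2 \<le> length p) \<and>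
     disjoint_family_on path_arcs S \<and> (\<Union>p\<in>S. path_arcs p) = E"

lemma path_partitionD:
  assumes "path_partition E S"
  shows "finite S" "p \<in> S \<Longrightarrow> distinct p" "p \<in> S \<Longrightarrow> 2 \<le> length p" "p \<in> S \<Longrightarrow> p \<noteq> []"
    "p \<in> S \<Longrightarrow> path_arcs p \<subseteq> E" "(\<Union>p\<in>S. path_arcs p) = E" "disjoint_family_on path_arcs S"
    "p \<in> S \<Longrightarrow> q \<in> S \<Longrightarrow> e \<in> path_arcs p \<Longrightarrow> e \<in> path_arcs q \<Longrightarrow> p = q"
  using assms unfolding path_partition_def disjoint_family_on_def by (fastforce)+

lemma path_partition_empty: "path_partition {} {}"
  by (simp add: path_partition_def disjoint_family_on_def)

lemma path_partition_Un:
  assumes "path_partition E S" "path_partition F R" "E \<inter> F = {}"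
  shows "path_partition (E \<union> F) (S \<union> R)"
proof -
  have "disjoint_family_on path_arcs (S \<union> R)"
    unfolding disjoint_family_on_def
  proof (intro ballI impI)
    fix p q assume "p \<in> S \<union> R" "q \<in> S \<union> R" "p \<noteq> q"
    then show "path_arcs p \<inter> path_arcs q = {}"
      using assms(3) path_partitionD(5,8)[OF assms(1)] path_partitionD(5,8)[OF assms(2)]
      by blast
  qed
  then show ?thesis using assms unfolding path_partition_def by auto
qed

lemma path_partition_single:
  "distinct p \<Longrightarrow> 2 \<le> length p \<Longrightarrow> path_partition (path_arcs p) {p}"
  by (auto simp: path_partition_def disjoint_family_on_def)

lemma path_partition_arcs:
  assumes "finite F" "\<And>u v. (u, v) \<in> F \<Longrightarrow> u \<noteq> v"
  shows "path_partition F ((\<lambda>(u, v). [u, v]) ` F)"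
  using assms by (auto simp: path_partition_def disjoint_family_on_def)

lemma starts_Un_le: "finite S \<Longrightarrow> finite R \<Longrightarrow> starts (S \<union> R) v \<le> starts S v + starts R v"
  unfolding starts_def
  by (rule order_trans[OF _ card_Un_le]) (auto intro!: card_mono)

lemma ends_Un_le: "finite S \<Longrightarrow> finite R \<Longrightarrow> ends (S \<union> R) v \<le> ends S v + ends R v"
  unfolding ends_def
  by (rule order_trans[OF _ card_Un_le]) (auto intro!: card_mono)

lemma sum_starts: "finite V \<Longrightarrow> finite S \<Longrightarrow> (\<And>p. p \<in> S \<Longrightarrow> hd p \<in> V) \<Longrightarrow> (\<Sum>v\<in>V. starts S v) = card S"
  unfolding starts_def
  by (subst card_UN_disjoint[symmetric]) (auto intro!: arg_cong[of _ _ card])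

lemma sum_ends: "finite V \<Longrightarrow> finite S \<Longrightarrow> (\<And>p. p \<in> S \<Longrightarrow> last p \<in> V) \<Longrightarrow> (\<Sum>v\<in>V. ends S v) = card S"
  unfolding ends_def
  by (subst card_UN_disjoint[symmetric]) (auto intro!: arg_cong[of _ _ card])

text \<open>A path counts only at its two ends. Hence where \<open>starts S v\<close> or
  \<open>ends S v\<close> vanishes, \<open>starts S v\<close> is the positive part of the excess;
  this gives the size of the final decomposition.\<close>

lemma arc_excess_partition:
  assumes "path_partition E S"
  shows "arc_excess E v = int (starts S v) - int (ends S v)"
proof -
  note P = path_partitionD[OF assms]
  have "arc_excess E v = (\<Sum>p\<in>S. arc_excess (path_arcs p) v)"
    unfolding arc_excess_def P(6)[symmetric]
    by (rule sum.UNION_disjoint) (use P in \<open>auto simp: disjoint_family_on_def\<close>)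
  also have "\<dots> = (\<Sum>p\<in>S. of_bool (hd p = v) - of_bool (last p = v))"
    using P by (intro sum.cong arc_excess_path) auto
  also have "\<dots> = int (starts S v) - int (ends S v)"
    using P(1) by (simp add: sum_subtractf starts_def ends_def of_bool_def sum.If_cases Int_def)
  finally show ?thesis .
qed

section \<open>Paths and cycles\<close>

definition cycle_arcs :: "'a list \<Rightarrow> ('a \<times> 'a) set" where
  "cycle_arcs c = path_arcs (c @ [hd c])"

text \<open>The arc sets in question contain no opposite arcs, so 3 is the least possible length. It
  also provides the two consecutive arcs from which \<open>cycles_to_paths\<close> takes its
  cuts.\<close>

definition cycle_family :: "('a \<times> 'a) set \<Rightarrow> 'a list set \<Rightarrow> bool" where
  "cycle_family E C \<longleftrightarrow> finite C \<and> (\<forall>c\<in>C. distinct c \<and> 3 \<le> length c \<and> cycle_arcs c \<subseteq> E) \<and>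
     disjoint_family_on cycle_arcs C"

lemma cycle_familyD:
  assumes "cycle_family E C"
  shows "finite C" "c \<in> C \<Longrightarrow> distinct c" "c \<in> C \<Longrightarrow> 3 \<le> length c" "c \<in> C \<Longrightarrow> c \<noteq> []"
    "c \<in> C \<Longrightarrow> cycle_arcs c \<subseteq> E"
    "c \<in> C \<Longrightarrow> d \<in> C \<Longrightarrow> e \<in> cycle_arcs c \<Longrightarrow> e \<in> cycle_arcs d \<Longrightarrow> c = d"
  using assms unfolding cycle_family_def disjoint_family_on_def by (fastforce)+

lemma cycle_arcs_conv: "c \<noteq> [] \<Longrightarrow> cycle_arcs c = insert (last c, hd c) (path_arcs c)"
  by (simp add: cycle_arcs_def path_arcs_append_hd)

lemma longest_path_exists:
  assumes "finite E" "E \<noteq> {}" and asym: "\<And>u v. (u, v) \<in> E \<Longrightarrow> (v, u) \<notin> E"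
  obtains p where "distinct p" "2 \<le> length p" "path_arcs p \<subseteq> E"
    "\<And>q. distinct q \<Longrightarrow> path_arcs q \<subseteq> E \<Longrightarrow> length q \<le> length p"
proof -
  obtain u v where uv: "(u, v) \<in> E" using assms(2) by auto
  let ?P = "\<lambda>p. distinct p \<and> path_arcs p \<subseteq> E"
  have bound: "length q < card E + 2" if "?P q" for q
    using that card_path_arcs[of q] card_mono[of E "path_arcs q"] assms(1) by auto
  have "u \<noteq> v" using uv asym by blast
  then have uvP: "?P [u, v]" using uv by auto
  obtain p where p: "?P p" "\<And>q. ?P q \<Longrightarrow> length q \<le> length p"
    using ex_has_greatest_nat[of ?P "[u, v]" length "card E + 2"] uvP bound by blast
  show thesis
    by (rule that[of p]) (use p(1) p(2)[OF uvP] p(2) in auto)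
qed

lemma longest_path_end_out:
  assumes "distinct p" "p \<noteq> []" "path_arcs p \<subseteq> E" "(last p, w) \<in> E"
    and "\<And>q. distinct q \<Longrightarrow> path_arcs q \<subseteq> E \<Longrightarrow> length q \<le> length p"
  shows "w \<in> set p"
proof (rule ccontr)
  assume "w \<notin> set p"
  then show False
    using assms(5)[of "p @ [w]"] assms(1-4) by (auto simp: path_arcs_append_hd)
qed

text \<open>The segment of \<open>p\<close> from \<open>w\<close> on is closed by the arc back to
  \<open>w\<close>; lengths 1 and 2 would require a loop or two opposite arcs.\<close>

lemma cycle_from_back_arc:
  assumes "distinct p" "path_arcs p \<subseteq> E" "(last p, w) \<in> E" "w \<in> set p"
    and asym: "\<And>u v. (u, v) \<in> E \<Longrightarrow> (v, u) \<notin> E"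
  obtains c where "distinct c" "3 \<le> length c" "cycle_arcs c \<subseteq> E"
proof -
  obtain ys zs where p: "p = ys @ w # zs" using assms(4) by (auto simp: in_set_conv_decomp)
  let ?c = "w # zs"
  have sub: "path_arcs ?c \<subseteq> E"
    using assms(2) p path_arcs_append_subset(2)[of ?c ys] by auto
  have "3 \<le> length ?c"
  proof (cases zs)
    case Nil
    then show ?thesis using assms(3) p asym by auto
  next
    case (Cons a r)
    then show ?thesis using assms(3) p asym sub by (cases r) auto
  qed
  then show thesis
    using that[of ?c] sub assms(1,3) p by (auto simp: cycle_arcs_conv)
qed

text \<open>On a longest path, an arc leaving the last vertex or entering the first one has its
  other end on the path and would close a cycle.\<close>

lemma maximal_path_acyclic:
  assumes "finite E" "E \<noteq> {}" and asym: "\<And>u v. (u, v) \<in> E \<Longrightarrow> (v, u) \<notin> E"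
    and acyclic: "\<And>c. distinct c \<Longrightarrow> 3 \<le> length c \<Longrightarrow> \<not> cycle_arcs c \<subseteq> E"
  obtains p where "distinct p" "2 \<le> length p" "path_arcs p \<subseteq> E"
    "\<And>w. (w, hd p) \<notin> E" "\<And>w. (last p, w) \<notin> E"
proof -
  obtain p where p: "distinct p" "2 \<le> length p" "path_arcs p \<subseteq> E"
    "\<And>q. distinct q \<Longrightarrow> path_arcs q \<subseteq> E \<Longrightarrow> length q \<le> length p"
    using longest_path_exists[OF assms(1,2) asym] by metis
  have ne: "p \<noteq> []" using p(2) by auto
  have "(last p, w) \<notin> E" for w
    using longest_path_end_out[OF p(1) ne p(3) _ p(4)] cycle_from_back_arc[OF p(1,3) _ _ asym] acyclic
    by metis
  moreover have "(w, hd p) \<notin> E" for w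
  proof
    assume w: "(w, hd p) \<in> E"
    have "w \<in> set p"
    proof (rule ccontr)
      assume "w \<notin> set p"
      then show False using p(4)[of "w # p"] p(1-3) w ne by (cases p) auto
    qed
    then obtain ys zs where ps: "p = ys @ w # zs" by (auto simp: in_set_conv_decomp)
    let ?c = "ys @ [w]"
    have sub: "path_arcs ?c \<subseteq> E"
      using p(3) ps path_arcs_append_subset(1)[of ?c zs] by auto
    have hd: "hd ?c = hd p" using ps by (cases ys) auto
    have dist: "distinct ?c" using p(1) ps by auto
    have "3 \<le> length ?c"
    proof (cases ys)
      case Nil
      then show ?thesis using w ps asym by auto
    next
      case (Cons a r)
      then show ?thesis using w ps asym sub by (cases r) auto
    qed
    then show False using acyclic[of ?c] dist sub w hd by (auto simp: cycle_arcs_conv)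
  qed
  ultimately show thesis using that p by metis
qed

text \<open>Cycles are removed as long as there are any. In an acyclic set a maximal path leads from
  a vertex without entering arcs to one without leaving arcs, so no other path ends where it starts
  or starts where it ends.\<close>

lemma path_cycle_decomposition:
  assumes "finite E" and "\<And>u v. (u, v) \<in> E \<Longrightarrow> (v, u) \<notin> E"
  shows "\<exists>P C. path_partition (E - (\<Union>c\<in>C. cycle_arcs c)) P \<and> cycle_family E C \<and>
           (\<forall>v. starts P v = 0 \<or> ends P v = 0)"
  using assms
proof (induction "card E" arbitrary: E rule: less_induct)
  case less
  note asym = less.prems(2)
  consider "E = {}" | c where "distinct c" "3 \<le> length c" "cycle_arcs c \<subseteq> E"
    | "E \<noteq> {}" "\<And>c. distinct c \<Longrightarrow> 3 \<le> length c \<Longrightarrow> \<not> cycle_arcs c \<subseteq> E" by blast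
  then show ?case
  proof cases
    case 1
    then show ?thesis
      by (intro exI[of _ "{}"]) (auto simp: cycle_family_def path_partition_empty disjoint_family_on_def starts_def)
  next
    case (2 c)
    let ?E = "E - cycle_arcs c"
    have ne: "cycle_arcs c \<noteq> {}" using 2(2) by (subst cycle_arcs_conv) auto
    have "card ?E < card E" using less.prems(1) 2(3) ne by (intro psubset_card_mono) auto
    then obtain P C where PC: "path_partition (?E - (\<Union>c\<in>C. cycle_arcs c)) P" "cycle_family ?E C"
      "\<forall>v. starts P v = 0 \<or> ends P v = 0"
      using less.hyps[of ?E] less.prems by blast
    have "?E - (\<Union>c\<in>C. cycle_arcs c) = E - (\<Union>c\<in>insert c C. cycle_arcs c)" by auto
    moreover have "cycle_family E (insert c C)"
      using PC(2) 2 unfolding cycle_family_def disjoint_family_on_def by blast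
    ultimately show ?thesis using PC by metis
  next
    case 3
    obtain p where p: "distinct p" "2 \<le> length p" "path_arcs p \<subseteq> E"
      "\<And>w. (w, hd p) \<notin> E" "\<And>w. (last p, w) \<notin> E"
      using maximal_path_acyclic[OF less.prems(1) 3(1) asym 3(2)] by metis
    let ?E = "E - path_arcs p"
    have "path_arcs p \<noteq> {}" using p(2) by (subst path_arcs_empty_iff) auto
    then have "card ?E < card E" using less.prems(1) p(3) by (intro psubset_card_mono) auto
    then obtain P C where PC: "path_partition (?E - (\<Union>c\<in>C. cycle_arcs c)) P" "cycle_family ?E C"
      "\<forall>v. starts P v = 0 \<or> ends P v = 0"
      using less.hyps[of ?E] less.prems by blast
    \<comment> \<open>Deleting arcs creates no cycles, so the induction hypothesis returns paths
      only.\<close>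
    have C: "C = {}"
    proof (rule ccontr)
      assume "C \<noteq> {}"
      then obtain c where "c \<in> C" by auto
      then show False using cycle_familyD(2,3,5)[OF PC(2)] 3(2)[of c] by blast
    qed
    then have P: "path_partition ?E P" using PC(1) by simp
    have "path_arcs p \<union> ?E = E" "{p} \<union> P = insert p P" using p(3) by auto
    then have pp: "path_partition E (insert p P)"
      using path_partition_Un[OF path_partition_single[OF p(1,2)] P] by (metis Diff_disjoint)
    have arc_ends: "\<exists>w. (hd q, w) \<in> E" "\<exists>w. (w, last q) \<in> E" if "q \<in> P" for q
    proof -
      have q: "2 \<le> length q" "path_arcs q \<subseteq> E" using path_partitionD(3,5)[OF P that] by auto
      then obtain a b r where "q = a # b # r" by (metis Suc_le_length_iff numeral_2_eq_2)
      then show "\<exists>w. (hd q, w) \<in> E" using q(2) by auto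
      obtain r' b' a' where "rev q = b' # a' # r'"
        using q(1) by (metis Suc_le_length_iff length_rev numeral_2_eq_2)
      then have "q = rev (b' # a' # r')" by (metis rev_rev_ident)
      then have "q = rev r' @ [a', b']" by simp
      then have "(a', b') \<in> path_arcs q" "last q = b'"
        using path_arcs_append_subset(2)[of "[a', b']" "rev r'"] by auto
      then show "\<exists>w. (w, last q) \<in> E" using q(2) by auto
    qed
    have hdlast: "hd p \<noteq> last p"
      using p(1,2) by (cases p; cases "tl p") auto
    have "starts (insert p P) v = 0 \<or> ends (insert p P) v = 0" for v
    proof -

      consider "v = hd p" | "v = last p" | "v \<noteq> hd p" "v \<noteq> last p" by auto
      then show ?thesis
      proof cases
        case 1
        then have "{q \<in> insert p P. last q = v} = {}" using hdlast arc_ends(2) p(4) by fastforce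
        then show ?thesis unfolding ends_def by (metis card.empty)
      next
        case 2
        then have "{q \<in> insert p P. hd q = v} = {}" using hdlast arc_ends(1) p(5) by fastforce
        then show ?thesis unfolding starts_def by (metis card.empty)
      next
        case 3
        then have "starts (insert p P) v = starts P v" "ends (insert p P) v = ends P v"
          unfolding starts_def ends_def by (auto intro!: arg_cong[of _ _ card])
        then show ?thesis using PC(3) by simp
      qed
    qed
    moreover have "cycle_family E {}" by (simp add: cycle_family_def disjoint_family_on_def)
    ultimately show ?thesis using pp by (metis Diff_empty UN_empty)
  qed
qed

text \<open>The last vertex of a longest path has out-degree less than \<open>K\<close>, so deleting it destroys fewer
  than \<open>K\<close> arc-disjoint cycles.\<close>

lemma card_cycle_family_le:
  assumes "finite V" "E \<subseteq> V \<times> V" "\<And>u v. (u, v) \<in> E \<Longrightarrow> (v, u) \<notin> E"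
    and "\<And>p. distinct p \<Longrightarrow> path_arcs p \<subseteq> E \<Longrightarrow> length p \<le> K"
    and "cycle_family E C"
  shows "card C \<le> K * card V"
  using assms
proof (induction "card V" arbitrary: V E C rule: less_induct)
  case less
  note C = cycle_familyD[OF less.prems(5)]
  show ?case
  proof (cases "E = {}")
    case True
    then have "C = {}" using C(3-5) cycle_arcs_conv by fastforce
    then show ?thesis by simp
  next
    case False
    have finE: "finite E" using less.prems(1,2) by (meson finite_SigmaI finite_subset)
    obtain p where p: "distinct p" "2 \<le> length p" "path_arcs p \<subseteq> E"
      "\<And>q. distinct q \<Longrightarrow> path_arcs q \<subseteq> E \<Longrightarrow> length q \<le> length p"
      using longest_path_exists[OF finE False less.prems(3)] by metis
    have ne: "p \<noteq> []" using p(2) by auto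
    define v where "v = last p"
    have vV: "v \<in> V"
    proof -
      have "butlast p \<noteq> []" using p(2) by (cases p; cases "tl p") auto
      then have "(last (butlast p), v) \<in> path_arcs p"
        using path_arcs_append_hd[of "butlast p" "[last p]"] ne by (simp add: v_def)
      then show ?thesis using p(3) less.prems(2) by auto
    qed
    define D where "D = {c \<in> C. v \<in> set c}"
    have out: "{w. (v, w) \<in> E} \<subseteq> set p"
      using longest_path_end_out[OF p(1) ne p(3) _ p(4)] unfolding v_def by blast
    have next_arc: "\<exists>w. (v, w) \<in> cycle_arcs c" if "c \<in> D" for c
    proof -
      have "v \<in> set c" using that by (simp add: D_def)
      then obtain ys zs where "c = ys @ v # zs" by (meson split_list)
      then have "cycle_arcs c = path_arcs ((ys @ [v]) @ (zs @ [hd c]))" by (simp add: cycle_arcs_def)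
      then show ?thesis by (subst (asm) path_arcs_append_hd) auto
    qed
    \<comment> \<open>The head of the arc by which \<open>c\<close> leaves \<open>v\<close>. It
      determines \<open>c\<close> because the cycles are arc-disjoint, and it lies on
      \<open>p\<close> because \<open>p\<close> cannot be prolonged.\<close>
    define f where "f c = (SOME w. (v, w) \<in> cycle_arcs c)" for c
    have f: "(v, f c) \<in> cycle_arcs c" if "c \<in> D" for c
      unfolding f_def using someI_ex[OF next_arc[OF that]] .
    have "inj_on f D"
    proof (rule inj_onI)
      fix c d assume "c \<in> D" "d \<in> D" "f c = f d"
      then show "c = d" using f[of c] f[of d] C(6)[of c d "(v, f c)"] unfolding D_def by auto
    qed
    moreover have "f ` D \<subseteq> set p"
      using f C(5) out unfolding D_def by blast
    ultimately have "card D \<le> card (set p)" by (meson List.finite_set card_inj_on_le)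
    also have "\<dots> \<le> K" using less.prems(4)[OF p(1,3)] p(1) by (simp add: distinct_card)
    finally have cardD: "card D \<le> K" .
    let ?E = "E \<inter> ((V - {v}) \<times> (V - {v}))"
    have "cycle_family ?E (C - D)"
      unfolding cycle_family_def
    proof (intro conjI ballI)
      show "finite (C - D)" using C(1) by simp
      show "disjoint_family_on cycle_arcs (C - D)"
        using less.prems(5) unfolding cycle_family_def disjoint_family_on_def by blast
      fix c assume c: "c \<in> C - D"
      then show "distinct c" "3 \<le> length c" using C by auto
      have "cycle_arcs c \<subseteq> set c \<times> set c"
        using path_arcs_subset_set[of "c @ [hd c]"] C(4)[of c] c unfolding cycle_arcs_def by auto
      then show "cycle_arcs c \<subseteq> ?E"
        using c C(5)[of c] less.prems(2) unfolding D_def by blast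
    qed
    moreover have "card (V - {v}) < card V" using vV less.prems(1) by (meson card_Diff1_less)
    ultimately have "card (C - D) \<le> K * card (V - {v})"
      using less.prems(1,3,4) by (intro less.hyps[of "V - {v}" ?E]) auto
    then have "card C \<le> K + K * card (V - {v})"
      using cardD C(1) card_Un_le[of D "C - D"] by (simp add: D_def Un_absorb1)
    also have "\<dots> = K * card V"
      using card_Suc_Diff1[OF less.prems(1) vV] by (metis mult_Suc_right)
    finally show ?thesis .
  qed
qed

text \<open>Endpoints are preferred outside the set \<open>H\<close> of vertices lying on more than \<open>q\<close> of the arcs; an
  arc of which an endpoint in \<open>H\<close> is picked lies inside \<open>H\<close>, and \<open>card H \<le> q\<close>.\<close>

lemma balanced_endpoint_choice:
  fixes e :: "'i \<Rightarrow> 'a \<times> 'a"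
  assumes "finite I" "inj_on e I" "2 * card I \<le> q * q"
  obtains p where "\<And>i. i \<in> I \<Longrightarrow> p i = fst (e i) \<or> p i = snd (e i)"
    "\<And>v. card {i \<in> I. p i = v} \<le> q"
proof -
  define deg where "deg v = card {i \<in> I. fst (e i) = v} + card {i \<in> I. snd (e i) = v}" for v
  define V where "V = fst ` e ` I \<union> snd ` e ` I"
  have finV: "finite V" using assms(1) by (simp add: V_def)
  define H where "H = {v \<in> V. q < deg v}"
  have finH: "finite H" using finV by (simp add: H_def)
  have sum_fst: "(\<Sum>v\<in>V. card {i \<in> I. fst (e i) = v}) = card I"
    by (subst card_UN_disjoint[symmetric]) (use assms(1) finV in \<open>auto intro!: arg_cong[of _ _ card] simp: V_def\<close>)
  have sum_snd: "(\<Sum>v\<in>V. card {i \<in> I. snd (e i) = v}) = card I"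
    by (subst card_UN_disjoint[symmetric]) (use assms(1) finV in \<open>auto intro!: arg_cong[of _ _ card] simp: V_def\<close>)
  \<comment> \<open>The degrees sum to \<open>2 * card I\<close>, so more than \<open>q\<close>
    vertices of degree above \<open>q\<close> would push the sum beyond
    \<open>q * q\<close>.\<close>
  have "(\<Sum>v\<in>H. Suc q) \<le> (\<Sum>v\<in>H. deg v)" by (rule sum_mono) (auto simp: H_def)
  also have "\<dots> \<le> (\<Sum>v\<in>V. deg v)" using finV by (intro sum_mono2) (auto simp: H_def)
  also have "\<dots> = 2 * card I" by (simp add: deg_def sum.distrib sum_fst sum_snd)
  finally have "card H * q + card H \<le> q * q" using assms(3) by simp
  then have cardH: "card H \<le> q"
    using mult_le_mono1[of "Suc q" "card H" q] by (cases "Suc q \<le> card H") auto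
  define p where "p i = (if fst (e i) \<notin> H then fst (e i) else if snd (e i) \<notin> H then snd (e i) else fst (e i))" for i
  have "card {i \<in> I. p i = v} \<le> q" for v
  proof (cases "v \<in> H")
    case True
    \<comment> \<open>A vertex of \<open>H\<close> is picked only in the last branch, as a first
      endpoint; the arc is then determined by its second endpoint, which is in \<open>H\<close>
      too.\<close>
    have "inj_on (\<lambda>i. snd (e i)) {i \<in> I. p i = v}"
    proof (rule inj_onI)
      fix i j assume "i \<in> {i \<in> I. p i = v}" "j \<in> {i \<in> I. p i = v}" "snd (e i) = snd (e j)"
      then show "i = j" using True assms(2)
        by (auto simp: p_def inj_on_def prod_eq_iff split: if_splits)
    qed
    moreover have "(\<lambda>i. snd (e i)) ` {i \<in> I. p i = v} \<subseteq> H"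
      using True by (auto simp: p_def split: if_splits)
    ultimately have "card {i \<in> I. p i = v} \<le> card H" using finH by (meson card_inj_on_le)
    then show ?thesis using cardH by simp
  next
    case False
    have "{i \<in> I. p i = v} \<subseteq> {i \<in> I. fst (e i) = v} \<union> {i \<in> I. snd (e i) = v}"
      by (auto simp: p_def split: if_splits)
    then have "card {i \<in> I. p i = v} \<le> deg v"
      unfolding deg_def using assms(1) by (intro order_trans[OF card_mono card_Un_le]) auto
    moreover have "deg v \<le> q \<or> deg v = 0"
    proof (cases "v \<in> V")
      case False
      then have "{i \<in> I. fst (e i) = v} = {}" "{i \<in> I. snd (e i) = v} = {}" by (auto simp: V_def)
      then show ?thesis unfolding deg_def by (simp only: card.empty add_0 simp_thms)
    next
      case True
      then show ?thesis using \<open>v \<notin> H\<close> by (simp add: H_def)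
    qed
    ultimately show ?thesis by auto
  qed
  moreover have "p i = fst (e i) \<or> p i = snd (e i)" for i by (auto simp: p_def)
  ultimately show thesis using that by metis
qed

section \<open>Partitions into short paths\<close>

text \<open>Meant for cycles cut at the two vertices \<open>f c\<close> and \<open>g c\<close>, with
  \<open>A c\<close> the set of pieces that start, or that end, at \<open>v\<close>.\<close>

lemma card_UN_at_most_one_le:
  assumes "finite C" "\<And>c. c \<in> C \<Longrightarrow> finite (A c)"
    and "\<And>c. c \<in> C \<Longrightarrow> card (A c) \<le> (if f c = v then 1 else 0) + (if g c = v then 1 else 0 :: nat)"
  shows "card (\<Union>c\<in>C. A c) \<le> card {c \<in> C. f c = v} + card {c \<in> C. g c = v}"
proof -
  have "card (\<Union>c\<in>C. A c) \<le> (\<Sum>c\<in>C. card (A c))" by (rule card_UN_le[OF assms(1)])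
  also have "\<dots> \<le> (\<Sum>c\<in>C. (if f c = v then 1 else 0) + (if g c = v then 1 else 0))"
    by (rule sum_mono) (use assms(3) in auto)
  also have "\<dots> = card {c \<in> C. f c = v} + card {c \<in> C. g c = v}"
    using assms(1) by (simp add: sum.distrib sum.If_cases Int_def)
  finally show ?thesis .
qed

lemma cycle_arcs_rotate1: "cycle_arcs (rotate1 c) = cycle_arcs c"
proof (cases c)
  case (Cons a r)
  then show ?thesis
    using path_arcs_append_hd[of "r @ [a]" "[hd r]"] by (cases r) (auto simp: cycle_arcs_def path_arcs_append_hd)
qed simp

text \<open>The tails of the arcs separate the pieces: they have index below \<open>i\<close> in
  \<open>p\<close> and at least \<open>i\<close> in \<open>q\<close>. Positivity of \<open>i\<close>
  keeps \<open>hd c\<close> from occurring twice in \<open>q\<close>.\<close>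

lemma cycle_cut:
  assumes "distinct c" "0 < i" "i < length c"
  defines "p \<equiv> take (Suc i) c" and "q \<equiv> drop i c @ [hd c]"
  shows "distinct p" "distinct q" "2 \<le> length p" "2 \<le> length q"
    "path_arcs p \<union> path_arcs q = cycle_arcs c" "path_arcs p \<inter> path_arcs q = {}"
    "hd p = hd c" "last p = c ! i" "hd q = c ! i" "last q = hd c"
proof -
  have ne: "c \<noteq> []" using assms by auto
  have hdi: "hd (drop i c) = c ! i" using assms by (simp add: hd_drop_conv_nth)
  have split: "take i c @ drop i c = c" by simp

  have "hd c \<in> set (take i c)" using assms ne by (cases c; cases i) auto
  then have hdnot: "hd c \<notin> set (drop i c)"
    using assms(1) split by (metis distinct_append disjoint_iff)
  have lastp: "last p = c ! i" using assms by (simp add: p_def take_Suc_conv_app_nth)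
  have p_eq: "p = take i c @ [c ! i]" using assms by (simp add: p_def take_Suc_conv_app_nth)
  show "distinct p" "distinct q" "2 \<le> length p" "2 \<le> length q" "hd p = hd c"
    "last p = c ! i" "hd q = c ! i" "last q = hd c"
    using assms ne hdnot lastp hdi by (auto simp: p_def q_def)
  have qtl: "p @ tl q = c @ [hd c]"
  proof -
    have "drop i c = c ! i # drop (Suc i) c" using assms(3) by (simp add: Cons_nth_drop_Suc)
    then have "tl q = drop (Suc i) c @ [hd c]" by (simp add: q_def)
    then show ?thesis by (simp add: p_def)
  qed
  show "path_arcs p \<union> path_arcs q = cycle_arcs c"
    unfolding cycle_arcs_def qtl[symmetric]
    by (rule path_arcs_glue[symmetric]) (use ne lastp hdi assms in \<open>auto simp: p_def q_def\<close>)
  show "path_arcs p \<inter> path_arcs q = {}"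
  proof (rule ccontr)
    assume "path_arcs p \<inter> path_arcs q \<noteq> {}"
    then obtain u w where uw: "(u, w) \<in> path_arcs p" "(u, w) \<in> path_arcs q" by auto
    have "u \<in> set (take i c)" using path_arcs_fst_butlast[OF uw(1)] p_eq by simp
    moreover have "u \<in> set (drop i c)" using path_arcs_fst_butlast[OF uw(2)] by (simp add: q_def)
    ultimately show False using assms(1) split by (metis distinct_append disjoint_iff)
  qed
qed

text \<open>Every cycle is cut at two vertices: first at an endpoint of one of its arcs, then at an endpoint
  of an arc avoiding the first cut.\<close>

lemma cycles_to_paths:
  assumes C: "cycle_family E C" and card: "2 * card C \<le> q * q"
  obtains S where "path_partition (\<Union>c\<in>C. cycle_arcs c) S"
    "\<And>v. starts S v \<le> 2 * q" "\<And>v. ends S v \<le> 2 * q"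
proof -
  note CD = cycle_familyD[OF C]
  have arc01: "(c ! 0, c ! 1) \<in> cycle_arcs c \<and> (c ! 1, c ! 2) \<in> cycle_arcs c" if len: "3 \<le> length c" for c :: "'a list"
  proof -
    obtain a b d r where "c = a # b # d # r"
      using len by (metis Suc_le_length_iff numeral_3_eq_3)
    then show ?thesis by (simp add: cycle_arcs_def)
  qed
  have "inj_on (\<lambda>c. (c ! 0, c ! 1)) C"
    by (rule inj_onI) (metis CD(3,6) arc01)
  from balanced_endpoint_choice[OF CD(1) this card] obtain p1 where
    p1: "\<And>c. c \<in> C \<Longrightarrow> p1 c = c ! 0 \<or> p1 c = c ! 1" "\<And>v. card {c \<in> C. p1 c = v} \<le> q"
    by auto
  \<comment> \<open>Rotation brings the first cut to the head, whichever of the two candidates it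
    is; the arc from \<open>R c ! 1\<close> to \<open>R c ! 2\<close> then avoids it.\<close>
  define R where "R c = (if p1 c = c ! 0 then c else rotate1 c)" for c
  have R: "distinct (R c)" "3 \<le> length (R c)" "cycle_arcs (R c) = cycle_arcs c" "hd (R c) = p1 c"
    if c: "c \<in> C" for c
  proof -
    obtain a b r where "c = a # b # r"
      using CD(3)[OF c] by (metis Suc_le_length_iff numeral_3_eq_3)
    then show "distinct (R c)" "3 \<le> length (R c)" "hd (R c) = p1 c"
      using CD(2,3)[OF c] p1(1)[OF c] by (auto simp: R_def hd_append)
    show "cycle_arcs (R c) = cycle_arcs c" by (simp add: R_def cycle_arcs_rotate1)
  qed
  have "inj_on (\<lambda>c. (R c ! 1, R c ! 2)) C"
    by (rule inj_onI) (metis CD(6) R(2,3) arc01)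
  from balanced_endpoint_choice[OF CD(1) this card] obtain p2 where
    p2: "\<And>c. c \<in> C \<Longrightarrow> p2 c = R c ! 1 \<or> p2 c = R c ! 2" "\<And>v. card {c \<in> C. p2 c = v} \<le> q"
    by auto
  define i where "i c = (if p2 c = R c ! 1 then 1 else 2 :: nat)" for c
  have i: "0 < i c" "i c < length (R c)" "R c ! i c = p2 c" if "c \<in> C" for c
    using p2(1)[OF that] R(2)[OF that] by (auto simp: i_def)
  define P where "P c = take (Suc (i c)) (R c)" for c
  define Q where "Q c = drop (i c) (R c) @ [hd (R c)]" for c
  note cut = cycle_cut[OF R(1) i(1,2), folded P_def Q_def]
  have cutD: "hd (P c) = p1 c" "last (P c) = p2 c" "hd (Q c) = p2 c" "last (Q c) = p1 c"
    "path_arcs (P c) \<union> path_arcs (Q c) = cycle_arcs c" if "c \<in> C" for c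
    using cut[OF that that that] R(3,4)[OF that] i(3)[OF that] by simp_all
  define S where "S = (\<Union>c\<in>C. {P c, Q c})"
  have "path_partition (\<Union>c\<in>C. cycle_arcs c) S"
    unfolding path_partition_def
  proof (intro conjI)
    show "finite S" unfolding S_def using CD(1) by auto
    show "\<forall>p\<in>S. distinct p \<and> 2 \<le> length p" unfolding S_def using cut by auto
    show "(\<Union>p\<in>S. path_arcs p) = (\<Union>c\<in>C. cycle_arcs c)" unfolding S_def using cutD(5) by auto
    show "disjoint_family_on path_arcs S"
      unfolding disjoint_family_on_def
    proof (intro ballI impI)
      fix s t assume st: "s \<in> S" "t \<in> S" "s \<noteq> t"
      obtain c d where cd: "c \<in> C" "d \<in> C" "s \<in> {P c, Q c}" "t \<in> {P d, Q d}"
        using st unfolding S_def by auto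
      have "path_arcs s \<subseteq> cycle_arcs c" "path_arcs t \<subseteq> cycle_arcs d"
        using cd cutD(5) by auto
      moreover have "path_arcs s \<inter> path_arcs t = {}" if "c = d"
        using cut(6)[OF cd(1) cd(1) cd(1)] cd(3,4) st(3) that by auto
      ultimately show "path_arcs s \<inter> path_arcs t = {}"
        using CD(6)[OF cd(1,2)] by blast
    qed
  qed
  \<comment> \<open>At each of its two cut vertices a cycle yields one start and one end, and a
    vertex is a first cut at most \<open>q\<close> times and a second cut at most \<open>q\<close>
    times.\<close>
  moreover have "starts S v \<le> 2 * q" for v
  proof -
    have "{s \<in> S. hd s = v} = (\<Union>c\<in>C. {s \<in> {P c, Q c}. hd s = v})" unfolding S_def by auto
    also have "card \<dots> \<le> card {c \<in> C. p1 c = v} + card {c \<in> C. p2 c = v}"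
    proof (rule card_UN_at_most_one_le[OF CD(1)])
      fix c assume c: "c \<in> C"
      have "{s \<in> {P c, Q c}. hd s = v} \<subseteq> (if p1 c = v then {P c} else {}) \<union> (if p2 c = v then {Q c} else {})"
        using cutD[OF c] by auto
      then show "card {s \<in> {P c, Q c}. hd s = v} \<le> (if p1 c = v then 1 else 0) + (if p2 c = v then 1 else 0)"
        by (rule order_trans[OF card_mono[rotated]]) (auto simp: card_insert_if)
    qed auto
    finally show ?thesis unfolding starts_def using p1(2)[of v] p2(2)[of v] by linarith
  qed
  moreover have "ends S v \<le> 2 * q" for v
  proof -
    have "{s \<in> S. last s = v} = (\<Union>c\<in>C. {s \<in> {P c, Q c}. last s = v})" unfolding S_def by auto
    also have "card \<dots> \<le> card {c \<in> C. p1 c = v} + card {c \<in> C. p2 c = v}"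
    proof (rule card_UN_at_most_one_le[OF CD(1)])
      fix c assume c: "c \<in> C"
      have "{s \<in> {P c, Q c}. last s = v} \<subseteq> (if p1 c = v then {Q c} else {}) \<union> (if p2 c = v then {P c} else {})"
        using cutD[OF c] by auto
      then show "card {s \<in> {P c, Q c}. last s = v} \<le> (if p1 c = v then 1 else 0) + (if p2 c = v then 1 else 0)"
        by (rule order_trans[OF card_mono[rotated]]) (auto simp: card_insert_if)
    qed auto
    finally show ?thesis unfolding ends_def using p1(2)[of v] p2(2)[of v] by linarith
  qed
  ultimately show thesis using that by metis
qed

text \<open>After removing a maximal family of paths with \<open>L\<close> to \<open>L + 2\<close> arcs subject to the bound \<open>q\<close> on
  starts and ends, and all arcs between saturated vertices, no path with \<open>L + 2\<close> arcs is left: shortened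
  by an arc at either end if need be, it would join two unsaturated vertices.\<close>

lemma short_path_partition:
  assumes V: "finite V" "E \<subseteq> V \<times> V" and asym: "\<And>u v. (u, v) \<in> E \<Longrightarrow> (v, u) \<notin> E"
    and L: "1 \<le> L" "1 \<le> q" "2 * (card V * card V) \<le> L * (q * q)" "2 * ((L + 2) * card V) \<le> q * q"
  obtains S where "path_partition E S" "\<And>p. p \<in> S \<Longrightarrow> length p \<le> L + 3"
    "\<And>v. min (starts S v) (ends S v) \<le> 4 * q"
proof -
  have finE: "finite E" using V by (meson finite_SigmaI finite_subset)
  have "card E \<le> card (V \<times> V)" using V by (intro card_mono) auto
  then have cardE: "card E \<le> card V * card V" by (simp add: card_cartesian_product)
  let ?Q = "\<lambda>R. path_partition (\<Union>p\<in>R. path_arcs p) R \<and> (\<Union>p\<in>R. path_arcs p) \<subseteq> E \<and>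
     (\<forall>p\<in>R. L + 1 \<le> length p \<and> length p \<le> L + 3) \<and> (\<forall>v. starts R v \<le> q \<and> ends R v \<le> q)"
  have size: "L * card R \<le> card E" if "?Q R" for R
  proof -
    note RD = path_partitionD[OF conjunct1[OF that]]
    have "L * card R = (\<Sum>p\<in>R. L)" by simp
    also have "\<dots> \<le> (\<Sum>p\<in>R. card (path_arcs p))"
    proof (rule sum_mono)
      fix p assume p: "p \<in> R"
      then have "L + 1 \<le> length p" using that by blast
      then show "L \<le> card (path_arcs p)" using card_path_arcs[OF RD(2)[OF p]] by simp
    qed
    also have "\<dots> = card (\<Union>p\<in>R. path_arcs p)"
      by (rule card_UN_disjoint[symmetric]) (use RD in \<open>auto simp: disjoint_family_on_def\<close>)
    also have "\<dots> \<le> card E" using that finE by (intro card_mono) auto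
    finally show ?thesis .
  qed
  have "\<exists>R. ?Q R \<and> (\<forall>R'. ?Q R' \<longrightarrow> card R' \<le> card R)"
  proof (rule ex_has_greatest_nat[of ?Q "{}" card "card E + 1"])
    show "?Q {}" by (simp add: path_partition_empty starts_def ends_def)
    show "\<forall>R. ?Q R \<longrightarrow> card R < card E + 1"
    proof (intro allI impI)
      fix R assume "?Q R"
      then have "L * card R \<le> card E" by (rule size)
      moreover have "card R \<le> L * card R" using L(1) by simp
      ultimately show "card R < card E + 1" by linarith
    qed
  qed
  then obtain R where R: "?Q R" and Rmax: "\<And>R'. ?Q R' \<Longrightarrow> card R' \<le> card R" by blast
  define ER where "ER = (\<Union>p\<in>R. path_arcs p)"
  have RP: "path_partition ER R" and ERE: "ER \<subseteq> E" using R unfolding ER_def by auto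
  have Rle: "starts R v \<le> q" "ends R v \<le> q" for v using R by auto
  note RD = path_partitionD[OF RP]
  define H where "H = {v \<in> V. starts R v = q \<or> ends R v = q}"
  have finH: "finite H" using V(1) by (simp add: H_def)
  have inV: "hd p \<in> V \<and> last p \<in> V" if "2 \<le> length p" "path_arcs p \<subseteq> E" for p
  proof -
    obtain a b r where "p = a # b # r" using \<open>2 \<le> length p\<close> by (metis Suc_le_length_iff numeral_2_eq_2)
    then have 1: "hd p \<in> V" using V(2) \<open>path_arcs p \<subseteq> E\<close> by auto
    obtain r' b' a' where "rev p = b' # a' # r'"
      using \<open>2 \<le> length p\<close> by (metis Suc_le_length_iff length_rev numeral_2_eq_2)
    then have "p = rev (b' # a' # r')" by (metis rev_rev_ident)
    then have "p = rev r' @ [a', b']" by simp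
    then have "(a', last p) \<in> path_arcs p"
      using path_arcs_append_subset(2)[of "[a', b']" "rev r'"] by auto
    then show ?thesis using 1 V(2) \<open>path_arcs p \<subseteq> E\<close> by auto
  qed
  have Rin: "hd p \<in> V" "last p \<in> V" if "p \<in> R" for p
    using inV[of p] RD(3,5)[OF that] ERE by auto
  \<comment> \<open>Every saturated vertex takes at least \<open>q\<close> of the
    \<open>2 * card R\<close> endpoints, while \<open>R\<close> has at most
    \<open>card V * card V / L\<close> paths. The hypothesis on \<open>L * (q * q)\<close> is chosen
    to make this \<open>card H <= q\<close>.\<close>
  have "q * card H = (\<Sum>v\<in>H. q)" by simp
  also have "\<dots> \<le> (\<Sum>v\<in>H. starts R v + ends R v)" by (rule sum_mono) (auto simp: H_def)
  also have "\<dots> \<le> (\<Sum>v\<in>V. starts R v + ends R v)" using V(1) by (intro sum_mono2) (auto simp: H_def)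
  also have "\<dots> = 2 * card R" using sum_starts[OF V(1) RD(1) Rin(1)] sum_ends[OF V(1) RD(1) Rin(2)]
    by (simp add: sum.distrib)
  finally have "L * (q * card H) \<le> 2 * (L * card R)" by (simp add: mult.left_commute)
  also have "\<dots> \<le> 2 * (card V * card V)" using size[OF R] cardE by linarith
  also have "\<dots> \<le> L * (q * q)" by (rule L(3))
  finally have cardH: "card H \<le> q" using L(1,2) by simp

  define EH where "EH = (E - ER) \<inter> (H \<times> H)"
  \<comment> \<open>Arcs inside \<open>H\<close> become paths of their own; each vertex meets at
    most \<open>card H\<close> of them in either direction, which costs another
    \<open>q\<close>.\<close>
  define SH where "SH = (\<lambda>(u, v). [u, v]) ` EH"
  have EHne: "u \<noteq> v" if "(u, v) \<in> EH" for u v using that asym unfolding EH_def by blast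
  have SH: "path_partition EH SH"
    unfolding SH_def by (rule path_partition_arcs) (use EHne finE in \<open>auto simp: EH_def\<close>)
  have SHle: "starts SH v \<le> q" "ends SH v \<le> q" for v
  proof -
    have "{p \<in> SH. hd p = v} \<subseteq> (\<lambda>w. [v, w]) ` H" "{p \<in> SH. last p = v} \<subseteq> (\<lambda>w. [w, v]) ` H"
      by (auto simp: SH_def EH_def)
    then have "starts SH v \<le> card H" "ends SH v \<le> card H"
      unfolding starts_def ends_def using finH by (meson card_image_le card_mono finite_imageI le_trans)+
    then show "starts SH v \<le> q" "ends SH v \<le> q" using cardH by auto
  qed

  define F where "F = E - ER - EH"
  have FE: "F \<subseteq> E" by (auto simp: F_def)
  have Fasym: "(v, u) \<notin> F" if "(u, v) \<in> F" for u v using asym[of u v] that FE by blast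
  have short: "length p \<le> L + 2" if p: "distinct p" "path_arcs p \<subseteq> F" for p
  proof (rule ccontr)
    assume "\<not> length p \<le> L + 2"
    then have len: "L + 3 \<le> length p" by simp
    define r where "r = take (L + 3) p"
    have r: "distinct r" "length r = L + 3" "path_arcs r \<subseteq> F"
      using p len path_arcs_take_subset[of "L + 3" p] by (auto simp: r_def)
    obtain s where s: "distinct s" "L + 2 \<le> length s" "length s \<le> L + 3" "path_arcs s \<subseteq> F" "hd s \<notin> H"
    proof (cases "hd r \<in> H")
      case True
      obtain a b t where "r = a # b # t" using r(2) L(1)
        by (cases r; cases "tl r") auto
      then have "hd (tl r) \<notin> H" using True r(3) FE by (auto simp: F_def EH_def)
      then show thesis using that[of "tl r"] r path_arcs_tl_subset[of r] by (auto simp: distinct_tl)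
    next
      case False
      then show thesis using that[of r] r by auto
    qed
    obtain t where t: "distinct t" "L + 1 \<le> length t" "length t \<le> L + 3" "path_arcs t \<subseteq> F" "hd t \<notin> H" "last t \<notin> H"
    proof (cases "last s \<in> H")
      case True
      have ne: "butlast s \<noteq> []" "s \<noteq> []" using s(2) L(1) by (cases s; cases "tl s"; auto)+
      then have "(last (butlast s), last s) \<in> path_arcs s"
        using path_arcs_append_hd[of "butlast s" "[last s]"] by simp
      then have "last (butlast s) \<notin> H" using True s(4) FE by (auto simp: F_def EH_def)
      moreover have "hd (butlast s) = hd s" using ne by (cases s) auto
      ultimately show thesis using that[of "butlast s"] s path_arcs_butlast_subset[of s]
        by (auto simp: distinct_butlast)
    next
      case False
      then show thesis using that[of s] s by auto
    qed
    have t2: "2 \<le> length t" using t(2) L(1) by linarith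
    have tV: "hd t \<in> V" "last t \<in> V" using inV[of t] t2 t(4) FE by auto
    have tR: "t \<notin> R"
    proof
      assume "t \<in> R"
      then have "path_arcs t \<subseteq> ER" using RD(5) by blast
      then have "path_arcs t = {}" using t(4) by (auto simp: F_def)
      then show False using t2 by (simp add: path_arcs_empty_iff)
    qed
    have "path_arcs t \<inter> ER = {}" using t(4) by (auto simp: F_def)
    then have "path_partition (path_arcs t \<union> ER) ({t} \<union> R)"
      by (rule path_partition_Un[OF path_partition_single[OF t(1) t2] RP])
    moreover have "(\<Union>p\<in>insert t R. path_arcs p) = path_arcs t \<union> ER" by (auto simp: ER_def)
    moreover have "starts (insert t R) v \<le> q" for v
    proof (cases "v = hd t")
      case True
      then have "starts R v < q" using t(5) tV Rle(1)[of v] by (auto simp: H_def)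
      moreover have "{p \<in> insert t R. hd p = v} = insert t {p \<in> R. hd p = v}" using True by auto
      ultimately show ?thesis using tR RD(1) unfolding starts_def by simp
    next
      case False
      then have "{p \<in> insert t R. hd p = v} = {p \<in> R. hd p = v}" by auto
      then show ?thesis using Rle(1)[of v] unfolding starts_def by metis
    qed
    moreover have "ends (insert t R) v \<le> q" for v
    proof (cases "v = last t")
      case True
      then have "ends R v < q" using t(6) tV Rle(2)[of v] by (auto simp: H_def)
      moreover have "{p \<in> insert t R. last p = v} = insert t {p \<in> R. last p = v}" using True by auto
      ultimately show ?thesis using tR RD(1) unfolding ends_def by simp
    next
      case False
      then have "{p \<in> insert t R. last p = v} = {p \<in> R. last p = v}" by auto
      then show ?thesis using Rle(2)[of v] unfolding ends_def by metis
    qed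
    ultimately have "?Q (insert t R)"
      using t(2-4) FE ERE R by auto
    then have "card (insert t R) \<le> card R" by (rule Rmax)
    then show False using tR RD(1) by simp
  qed

  obtain P C where PC: "path_partition (F - (\<Union>c\<in>C. cycle_arcs c)) P" "cycle_family F C"
    "\<And>v. starts P v = 0 \<or> ends P v = 0"
    using path_cycle_decomposition[of F] finE FE Fasym by (metis finite_subset)
  have "card C \<le> (L + 2) * card V"
    by (rule card_cycle_family_le[OF V(1) _ Fasym short PC(2)]) (use FE V in auto)
  then have "2 * card C \<le> q * q" using L(4) by linarith
  from cycles_to_paths[OF PC(2) this] obtain SC where
    SC: "path_partition (\<Union>c\<in>C. cycle_arcs c) SC" "\<And>v. starts SC v \<le> 2 * q" "\<And>v. ends SC v \<le> 2 * q"
    by metis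
  have CF: "(\<Union>c\<in>C. cycle_arcs c) \<subseteq> F" using cycle_familyD(5)[OF PC(2)] by auto
  define X where "X = R \<union> SH \<union> SC"
  have "ER \<inter> EH = {}" by (auto simp: EH_def)
  from path_partition_Un[OF RP SH this]
  have "path_partition (ER \<union> EH \<union> (\<Union>c\<in>C. cycle_arcs c)) X"
    unfolding X_def by (rule path_partition_Un[OF _ SC(1)]) (use CF in \<open>auto simp: F_def\<close>)
  from path_partition_Un[OF this PC(1)]
  have "path_partition (ER \<union> EH \<union> (\<Union>c\<in>C. cycle_arcs c) \<union> (F - (\<Union>c\<in>C. cycle_arcs c))) (X \<union> P)"
    by (auto simp: F_def)
  moreover have "ER \<union> EH \<union> (\<Union>c\<in>C. cycle_arcs c) \<union> (F - (\<Union>c\<in>C. cycle_arcs c)) = E"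
    using CF ERE by (auto simp: F_def EH_def)
  ultimately have part: "path_partition E (X \<union> P)" by simp
  have finX: "finite X" "finite P" using path_partitionD(1)[OF part] by auto
  have len: "length p \<le> L + 3" if pX: "p \<in> X \<union> P" for p
  proof -
    consider "p \<in> R" | "p \<in> SH" | "p \<in> SC" | "p \<in> P" using pX unfolding X_def by auto
    then show ?thesis
    proof cases
      case 1
      then show ?thesis using R by auto
    next
      case 2
      then show ?thesis using L(1) by (auto simp: SH_def)
    next
      case 3
      then have "length p \<le> L + 2"
        using path_partitionD(2,5)[OF SC(1) 3] CF by (intro short) blast+
      then show ?thesis by simp
    next
      case 4
      then have "length p \<le> L + 2"
        using path_partitionD(2,5)[OF PC(1)] by (intro short) auto
      then show ?thesis by simp
    qed
  qed
  have Xle: "starts X v \<le> 4 * q" "ends X v \<le> 4 * q" for v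
  proof -
    have fin: "finite R" "finite SH" "finite SC" using finX unfolding X_def by auto
    show "starts X v \<le> 4 * q"
      using starts_Un_le[of "R \<union> SH" SC v] starts_Un_le[of R SH v] fin Rle(1)[of v] SHle(1)[of v] SC(2)[of v]
      unfolding X_def by simp
    show "ends X v \<le> 4 * q"
      using ends_Un_le[of "R \<union> SH" SC v] ends_Un_le[of R SH v] fin Rle(2)[of v] SHle(2)[of v] SC(3)[of v]
      unfolding X_def by simp
  qed
  \<comment> \<open>The \<open>4 * q\<close> is \<open>q\<close> for \<open>R\<close>,
    \<open>q\<close> for \<open>SH\<close> and \<open>2 * q\<close> for the cut cycles. At a given
    vertex \<open>P\<close> adds to the starts only or to the ends only, so the other count keeps
    this bound.\<close>
  have "min (starts (X \<union> P) v) (ends (X \<union> P) v) \<le> 4 * q" for v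
    using PC(3)[of v] starts_Un_le[OF finX, of v] ends_Un_le[OF finX, of v] Xle[of v] by auto
  then show thesis using that part len by metis
qed

section \<open>Absorbing paths\<close>

text \<open>Arcs inside \<open>S\<close> cancel in the sum of the excesses, which is therefore the
  number of arcs leaving \<open>S\<close> minus the number entering it; in a tournament these two
  numbers add up to \<open>card S * card (V - S)\<close>.\<close>

lemma card_cut_arcs_eq:
  assumes "finite V" "E \<subseteq> V \<times> V" "S \<subseteq> V"
    and tour: "\<And>u v. u \<in> V \<Longrightarrow> v \<in> V \<Longrightarrow> u \<noteq> v \<Longrightarrow> (u, v) \<in> E \<longleftrightarrow> (v, u) \<notin> E"
  shows "2 * int (card (E \<inter> (V - S) \<times> S)) = int (card S) * int (card (V - S)) - (\<Sum>v\<in>S. arc_excess E v)"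
proof -
  have finE: "finite E" using assms(1,2) by (meson finite_SigmaI finite_subset)
  have finS: "finite S" using assms(1,3) finite_subset by blast
  have "(\<Sum>v\<in>S. arc_excess E v) = (\<Sum>e\<in>E. \<Sum>v\<in>S. of_bool (fst e = v) - of_bool (snd e = v))"
    unfolding arc_excess_def by (rule sum.swap)
  also have "\<dots> = (\<Sum>e\<in>E. of_bool (fst e \<in> S) - of_bool (snd e \<in> S))"
    using finS by (simp add: sum_subtractf of_bool_def)
  also have "\<dots> = (\<Sum>e\<in>E. of_bool (e \<in> S \<times> (V - S)) - of_bool (e \<in> (V - S) \<times> S))"
    using assms(2,3) by (intro sum.cong) auto
  also have "\<dots> = int (card (E \<inter> S \<times> (V - S))) - int (card (E \<inter> (V - S) \<times> S))"
    using finE by (simp add: sum_subtractf of_bool_def sum.If_cases Int_def)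
  finally have diff: "(\<Sum>v\<in>S. arc_excess E v) = int (card (E \<inter> S \<times> (V - S))) - int (card (E \<inter> (V - S) \<times> S))" .
  have "(E \<inter> (V - S) \<times> S)\<inverse> = S \<times> (V - S) - E \<inter> S \<times> (V - S)"
    using tour assms(3) by blast
  then have "card (E \<inter> (V - S) \<times> S) = card (S \<times> (V - S) - E \<inter> S \<times> (V - S))"
    by (metis card_inverse)
  also have "\<dots> = card (S \<times> (V - S)) - card (E \<inter> S \<times> (V - S))"
    using finE by (intro card_Diff_subset) auto
  finally have "card (E \<inter> (V - S) \<times> S) + card (E \<inter> S \<times> (V - S)) = card S * card (V - S)"
    using card_mono[of "S \<times> (V - S)" "E \<inter> S \<times> (V - S)"] finS assms(1)
    by (simp add: card_cartesian_product)
  then have "int (card (E \<inter> (V - S) \<times> S)) + int (card (E \<inter> S \<times> (V - S))) = int (card S) * int (card (V - S))"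
    by (metis of_nat_add of_nat_mult)
  then show ?thesis using diff by linarith
qed

text \<open>Going backwards from \<open>x\<close>, the set of vertices not yet reached at least halves in every step, up
  to an additive error: a set \<open>S\<close> without vertices of excess \<open>s\<close> receives about half of the
  \<open>card S * card (V - S)\<close> arcs between \<open>S\<close> and its complement.\<close>

lemma short_path_from_high_excess:
  assumes V: "finite V" "E \<subseteq> V \<times> V" "x \<in> V" "x \<notin> F" "F \<subseteq> V"
    and tour: "\<And>u v. u \<in> V \<Longrightarrow> v \<in> V \<Longrightarrow> u \<noteq> v \<Longrightarrow> (u, v) \<in> E \<longleftrightarrow> (v, u) \<notin> E"
    and used: "\<And>v. v \<in> V \<Longrightarrow> card {u. (u, v) \<in> E \<inter> Z} \<le> d"
    and small: "d + card F < s"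
    and many: "3 * s \<le> card {v \<in> V. int s \<le> arc_excess E v}"
    and l: "card V \<le> 2 ^ l"
  obtains p where "distinct p" "p \<noteq> []" "last p = x" "int s \<le> arc_excess E (hd p)"
    "set p \<subseteq> V - F" "path_arcs p \<subseteq> E - Z" "length p \<le> Suc l"
proof -
  define T where "T = {(u, v). (u, v) \<in> E - Z \<and> u \<notin> F \<and> v \<notin> F}"
  \<comment> \<open>The vertices with a walk of at most \<open>i\<close> allowed arcs to
    \<open>x\<close>. For \<open>path\<close>, a vertex met again is no obstacle: the suffix of the
    path from that vertex serves.\<close>
  define D where "D = rec_nat {x} (\<lambda>_ X. X \<union> {u. \<exists>v\<in>X. (u, v) \<in> T})"
  have D: "D 0 = {x}" "\<And>i. D (Suc i) = D i \<union> {u. \<exists>v\<in>D i. (u, v) \<in> T}" by (simp_all add: D_def)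
  have DV: "D i \<subseteq> V - F" for i
    by (induction i) (use V in \<open>auto simp: D T_def\<close>)
  define A where "A = {v \<in> V. int s \<le> arc_excess E v}"
  have path: "\<exists>p. distinct p \<and> p \<noteq> [] \<and> last p = x \<and> hd p = v \<and> set p \<subseteq> V - F \<and> path_arcs p \<subseteq> E - Z \<and> length p \<le> Suc i"
    if "v \<in> D i" for v i
    using that
  proof (induction i arbitrary: v)
    case 0
    then show ?case using V by (intro exI[of _ "[x]"]) (auto simp: D)
  next
    case (Suc i)
    show ?case
    proof (cases "v \<in> D i")
      case True
      then show ?thesis using Suc.IH[of v] le_SucI by blast
    next
      case False
      then obtain w where w: "w \<in> D i" "(v, w) \<in> T" using Suc.prems by (auto simp: D)
      obtain p where p: "distinct p" "p \<noteq> []" "last p = x" "hd p = w" "set p \<subseteq> V - F"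
        "path_arcs p \<subseteq> E - Z" "length p \<le> Suc i"
        using Suc.IH[OF w(1)] by blast
      show ?thesis
      proof (cases "v \<in> set p")
        case True
        then obtain ys zs where ps: "p = ys @ v # zs" by (meson split_list)
        then show ?thesis
          using p path_arcs_append_subset(2)[of "v # zs" ys]
          by (intro exI[of _ "v # zs"]) auto
      next
        case False
        have "path_arcs (v # p) = insert (v, w) (path_arcs p)"
          using path_arcs_append_hd[of "[v]" p] p by simp
        then show ?thesis
          using p w False V(2) by (intro exI[of _ "v # p"]) (auto simp: T_def)
      qed
    qed
  qed
  have finD: "finite (D i)" for i using DV[of i] V(1) by (meson Diff_subset finite_subset)
  have "\<exists>i\<le>l. D i \<inter> A \<noteq> {}"
  proof (rule ccontr)
    assume "\<not> ?thesis"
    then have disj: "D i \<inter> A = {}" if "i \<le> l" for i using that by auto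
    have step: "2 * card (V - D (Suc i)) \<le> card (V - D i) + s + 2 * (d + card F)" if "i < l" for i
    proof -
      let ?S = "D i"
      have SV: "?S \<subseteq> V" using DV by auto
      have "(\<Sum>v\<in>?S. arc_excess E v) \<le> (\<Sum>v\<in>?S. int s)"
      proof (rule sum_mono)
        fix v assume "v \<in> ?S"
        then show "arc_excess E v \<le> int s" using disj[of i] that SV by (auto simp: A_def not_le)
      qed
      then have ex: "(\<Sum>v\<in>?S. arc_excess E v) \<le> int (card ?S) * int s" by simp
      \<comment> \<open>An arc entering \<open>D i\<close> comes from a vertex reached in the next
        step, or from \<open>F\<close>, or lies in \<open>Z\<close>. The last two kinds number at
        most \<open>card F + d\<close> per vertex of \<open>D i\<close>.\<close>
      have "E \<inter> (V - ?S) \<times> ?S \<subseteq> (D (Suc i) - ?S) \<times> ?S \<union> F \<times> ?S \<union> (\<Union>v\<in>?S. {u. (u, v) \<in> E \<inter> Z} \<times> {v})"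
        using DV[of i] by (auto simp: D T_def)
      then have "card (E \<inter> (V - ?S) \<times> ?S) \<le>
          card ((D (Suc i) - ?S) \<times> ?S \<union> F \<times> ?S \<union> (\<Union>v\<in>?S. {u. (u, v) \<in> E \<inter> Z} \<times> {v}))"
      proof (rule card_mono[rotated])
        have "{u. (u, v) \<in> E \<inter> Z} \<subseteq> V" for v using V(2) by auto
        then have "finite {u. (u, v) \<in> E \<inter> Z}" for v using V(1) by (meson finite_subset)
        then show "finite ((D (Suc i) - ?S) \<times> ?S \<union> F \<times> ?S \<union> (\<Union>v\<in>?S. {u. (u, v) \<in> E \<inter> Z} \<times> {v}))"
          using finD V(1,5) by (auto intro: finite_subset)
      qed
      also have "\<dots> \<le> card ((D (Suc i) - ?S) \<times> ?S) + card (F \<times> ?S) + card (\<Union>v\<in>?S. {u. (u, v) \<in> E \<inter> Z} \<times> {v})"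
        by (meson card_Un_le add_le_mono le_trans order_refl)
      also have "card (\<Union>v\<in>?S. {u. (u, v) \<in> E \<inter> Z} \<times> {v}) \<le> (\<Sum>v\<in>?S. d)"
        by (rule order_trans[OF card_UN_le[OF finD]], rule sum_mono)
          (use used SV in \<open>auto simp: card_cartesian_product\<close>)
      finally have "card (E \<inter> (V - ?S) \<times> ?S) \<le> card ?S * (card (D (Suc i) - ?S) + card F + d)"
        by (simp add: card_cartesian_product algebra_simps)
      then have "2 * int (card (E \<inter> (V - ?S) \<times> ?S)) \<le> int (card ?S) * (2 * int (card (D (Suc i) - ?S) + card F + d))"
        by (simp only: mult.left_commute[of "int (card ?S)" 2] mult_le_cancel_left_pos zero_less_numeral
            of_nat_le_iff flip: of_nat_mult)
      then have "int (card ?S) * int (card (V - ?S)) \<le> int (card ?S) * (2 * int (card (D (Suc i) - ?S) + card F + d)) + int (card ?S) * int s"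
        using card_cut_arcs_eq[OF V(1,2) SV tour] ex by linarith
      then have "int (card ?S) * int (card (V - ?S)) \<le> int (card ?S) * (2 * int (card (D (Suc i) - ?S) + card F + d) + int s)"
        by (simp add: algebra_simps)
      moreover have "0 < int (card ?S)"
      proof -
        have "x \<in> D i" by (induction i) (auto simp: D)
        then show ?thesis using finD[of i] card_gt_0_iff by fastforce
      qed
      ultimately have "int (card (V - ?S)) \<le> 2 * int (card (D (Suc i) - ?S) + card F + d) + int s"
        by (simp only: mult_le_cancel_left_pos)
      then have "int (card (V - ?S)) \<le> int (2 * (card (D (Suc i) - ?S) + card F + d) + s)"
        by (simp only: of_nat_add of_nat_mult of_nat_numeral)
      then have "card (V - ?S) \<le> 2 * (card (D (Suc i) - ?S) + card F + d) + s"
        by (simp only: of_nat_le_iff)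
      moreover have "card (V - ?S) = card (V - D (Suc i)) + card (D (Suc i) - ?S)"
      proof -
        have "V - ?S = (V - D (Suc i)) \<union> (D (Suc i) - ?S)" using D(2)[of i] DV[of "Suc i"] by blast
        then show ?thesis using V(1) finD by (metis card_Un_disjoint Diff_disjoint Int_Diff finite_Diff inf_commute Diff_Int_distrib2 empty_Diff Int_empty_left)
      qed
      moreover have "2 * b \<le> a + s + 2 * (d + f)" if "a \<le> 2 * (c + f + d) + s" "a = b + c" for a b c f :: nat
        using that by presburger
      ultimately show ?thesis by blast
    qed
    \<comment> \<open>The halving recursion solved with denominators cleared; the additive errors
      form a geometric series and stay below one copy of
      \<open>s + 2 * (d + card F)\<close>.\<close>
    have "2 ^ i * card (V - D i) \<le> card V + 2 ^ i * (s + 2 * (d + card F))" if "i \<le> l" for i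
      using that
    proof (induction i)
      case 0
      have "card (V - D 0) \<le> card V" using V(1) by (intro card_mono) auto
      then show ?case by simp
    next
      case (Suc i)
      have "2 ^ Suc i * card (V - D (Suc i)) = 2 ^ i * (2 * card (V - D (Suc i)))" by simp
      also have "\<dots> \<le> 2 ^ i * (card (V - D i) + s + 2 * (d + card F))"
        using step[of i] Suc.prems by (intro mult_le_mono2) auto
      also have "\<dots> = 2 ^ i * card (V - D i) + 2 ^ i * (s + 2 * (d + card F))" by (simp add: algebra_simps)
      also have "\<dots> \<le> card V + 2 ^ i * (s + 2 * (d + card F)) + 2 ^ i * (s + 2 * (d + card F))"
        using Suc by simp
      also have "\<dots> = card V + 2 ^ Suc i * (s + 2 * (d + card F))" by simp
      finally show ?case .
    qed
    \<comment> \<open>Since \<open>d + card F <= s - 1\<close>, at most \<open>3 * s - 1\<close>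
      vertices remain unreached, too few to contain \<open>A\<close>. This is the origin of the
      factor 3.\<close>
    from this[of l] have "2 ^ l * card (V - D l) \<le> 2 ^ l * (1 + (s + 2 * (d + card F)))"
      using l by (simp add: algebra_simps)
    then have "card (V - D l) \<le> 1 + (s + 2 * (d + card F))" by (simp only: mult_le_cancel1) simp
    moreover have "card A \<le> card (V - D l)"
      using disj[of l] V(1) by (intro card_mono) (auto simp: A_def)
    ultimately show False using many small unfolding A_def by presburger
  qed
  then obtain i v where i: "i \<le> l" "v \<in> D i" "v \<in> A" by auto
  obtain p where p: "distinct p" "p \<noteq> []" "last p = x" "hd p = v" "set p \<subseteq> V - F" "path_arcs p \<subseteq> E - Z"
    "length p \<le> Suc i" using path[OF i(2)] by blast
  show thesis by (rule that[of p]) (use p i in \<open>auto simp: A_def\<close>)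
qed

lemma arc_excess_converse: "arc_excess (E\<inverse>) v = - arc_excess E v"
proof -
  have "E\<inverse> = prod.swap ` E" by force
  then have "arc_excess (E\<inverse>) v = (\<Sum>e\<in>prod.swap ` E. of_bool (fst e = v) - of_bool (snd e = v))"
    by (simp add: arc_excess_def)
  also have "\<dots> = (\<Sum>e\<in>E. of_bool (snd e = v) - of_bool (fst e = v))"
    by (subst sum.reindex) auto
  also have "\<dots> = - arc_excess E v"
    unfolding arc_excess_def by (simp add: sum_negf[symmetric])
  finally show ?thesis .
qed

text \<open>Reversing all arcs negates the excess and turns paths around.\<close>

lemma short_path_to_low_excess:
  assumes V: "finite V" "E \<subseteq> V \<times> V" "x \<in> V" "x \<notin> F" "F \<subseteq> V"
    and tour: "\<And>u v. u \<in> V \<Longrightarrow> v \<in> V \<Longrightarrow> u \<noteq> v \<Longrightarrow> (u, v) \<in> E \<longleftrightarrow> (v, u) \<notin> E"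
    and used: "\<And>v. v \<in> V \<Longrightarrow> card {u. (v, u) \<in> E \<inter> Z} \<le> d"
    and small: "d + card F < s"
    and many: "3 * s \<le> card {v \<in> V. arc_excess E v \<le> - int s}"
    and l: "card V \<le> 2 ^ l"
  obtains p where "distinct p" "p \<noteq> []" "hd p = x" "arc_excess E (last p) \<le> - int s"
    "set p \<subseteq> V - F" "path_arcs p \<subseteq> E - Z" "length p \<le> Suc l"
proof -
  have 1: "E\<inverse> \<subseteq> V \<times> V" using V(2) by auto
  have "{v \<in> V. int s \<le> arc_excess (E\<inverse>) v} = {v \<in> V. arc_excess E v \<le> - int s}"
    by (auto simp: arc_excess_converse)
  then have 2: "3 * s \<le> card {v \<in> V. int s \<le> arc_excess (E\<inverse>) v}" using many by simp
  show thesis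
  proof (rule short_path_from_high_excess[OF V(1) 1 V(3-5) _ _ small 2 l])
    show "card {u. (u, v) \<in> E\<inverse> \<inter> Z\<inverse>} \<le> d" if "v \<in> V" for v using used[OF that] by simp
    show "(u, v) \<in> E\<inverse> \<longleftrightarrow> (v, u) \<notin> E\<inverse>" if "u \<in> V" "v \<in> V" "u \<noteq> v" for u v
      using tour[OF that(2,1)] that(3) by auto
    fix p assume p: "distinct p" "p \<noteq> []" "last p = x" "int s \<le> arc_excess (E\<inverse>) (hd p)"
      "set p \<subseteq> V - F" "path_arcs p \<subseteq> E\<inverse> - Z\<inverse>" "length p \<le> Suc l"
    show thesis
      by (rule that[of "rev p"]) (use p in \<open>auto simp: path_arcs_rev hd_rev last_rev arc_excess_converse\<close>)
  qed
qed

text \<open>An absorber with centre \<open>x\<close> is a pair \<open>(h, t)\<close> of paths, \<open>h\<close> ending and \<open>t\<close> starting in \<open>x\<close>.\<close>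

definition body :: "'a list \<times> 'a list \<Rightarrow> 'a set" where
  "body w = set (butlast (fst w)) \<union> set (tl (snd w))"

definition absorber_arcs :: "'a list \<times> 'a list \<Rightarrow> ('a \<times> 'a) set" where
  "absorber_arcs w = path_arcs (fst w) \<union> path_arcs (snd w)"

text \<open>Absorbers with a common centre have disjoint bodies, so a set of \<open>k\<close>
  vertices away from the centre obstructs at most \<open>k\<close> of them; this makes the choice in
  \<open>absorber_assignment\<close> possible. Across different centres only the arcs are disjoint.
  One half may be trivial, when the centre itself has large excess.\<close>

definition absorber_family ::
  "'a set \<Rightarrow> ('a \<times> 'a) set \<Rightarrow> nat \<Rightarrow> nat \<Rightarrow> ('a list \<times> 'a list) set \<Rightarrow> bool" where
  "absorber_family V E s l W \<longleftrightarrow> finite W \<and>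
     (\<forall>(h, t)\<in>W. h \<noteq> [] \<and> t \<noteq> [] \<and> last h = hd t \<and> distinct (h @ tl t) \<and> set h \<union> set t \<subseteq> V \<and>
        path_arcs h \<union> path_arcs t \<subseteq> E \<and> length h \<le> Suc l \<and> length t \<le> Suc l \<and>
        int s \<le> arc_excess E (hd h) \<and> arc_excess E (last t) \<le> - int s) \<and>
     disjoint_family_on absorber_arcs W \<and>
     (\<forall>w\<in>W. \<forall>w'\<in>W. w \<noteq> w' \<longrightarrow> hd (snd w) = hd (snd w') \<longrightarrow> body w \<inter> body w' = {})"

lemma absorber_familyD:
  assumes "absorber_family V E s l W"
  shows "finite W" "(h, t) \<in> W \<Longrightarrow> h \<noteq> []" "(h, t) \<in> W \<Longrightarrow> t \<noteq> []" "(h, t) \<in> W \<Longrightarrow> last h = hd t"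
    "(h, t) \<in> W \<Longrightarrow> distinct (h @ tl t)" "(h, t) \<in> W \<Longrightarrow> set h \<union> set t \<subseteq> V"
    "(h, t) \<in> W \<Longrightarrow> path_arcs h \<union> path_arcs t \<subseteq> E" "(h, t) \<in> W \<Longrightarrow> length h \<le> Suc l"
    "(h, t) \<in> W \<Longrightarrow> length t \<le> Suc l" "(h, t) \<in> W \<Longrightarrow> int s \<le> arc_excess E (hd h)"
    "(h, t) \<in> W \<Longrightarrow> arc_excess E (last t) \<le> - int s"
    "w \<in> W \<Longrightarrow> w' \<in> W \<Longrightarrow> e \<in> absorber_arcs w \<Longrightarrow> e \<in> absorber_arcs w' \<Longrightarrow> w = w'"
    "w \<in> W \<Longrightarrow> w' \<in> W \<Longrightarrow> hd (snd w) = hd (snd w') \<Longrightarrow> a \<in> body w \<Longrightarrow> a \<in> body w' \<Longrightarrow> w = w'"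
proof -
  note W = assms[unfolded absorber_family_def]
  show "finite W" using W by blast
  show "h \<noteq> []" "t \<noteq> []" "last h = hd t" "distinct (h @ tl t)" "set h \<union> set t \<subseteq> V"
    "path_arcs h \<union> path_arcs t \<subseteq> E" "length h \<le> Suc l" "length t \<le> Suc l"
    "int s \<le> arc_excess E (hd h)" "arc_excess E (last t) \<le> - int s" if "(h, t) \<in> W"
    using bspec[OF conjunct1[OF conjunct2[OF W]] that] by simp_all
  show "w = w'" if "w \<in> W" "w' \<in> W" "e \<in> absorber_arcs w" "e \<in> absorber_arcs w'"
    using W that unfolding disjoint_family_on_def by blast
  show "w = w'" if "w \<in> W" "w' \<in> W" "hd (snd w) = hd (snd w')" "a \<in> body w" "a \<in> body w'"
    using W that by blast
qed

lemma absorber_family_subset: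
  assumes "absorber_family V E s l W" "W' \<subseteq> W"
  shows "absorber_family V E s l W'"
  unfolding absorber_family_def
proof (intro conjI)
  note W = assms(1)[unfolded absorber_family_def]
  show "finite W'" using W assms(2) finite_subset by blast
  show "\<forall>(h, t)\<in>W'. h \<noteq> [] \<and> t \<noteq> [] \<and> last h = hd t \<and> distinct (h @ tl t) \<and> set h \<union> set t \<subseteq> V \<and>
        path_arcs h \<union> path_arcs t \<subseteq> E \<and> length h \<le> Suc l \<and> length t \<le> Suc l \<and>
        int s \<le> arc_excess E (hd h) \<and> arc_excess E (last t) \<le> - int s"
    by (rule ballI, rule bspec[OF conjunct1[OF conjunct2[OF W]]], rule subsetD[OF assms(2)])
  show "disjoint_family_on absorber_arcs W'"
    using W assms(2) disjoint_family_on_mono by blast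
  show "\<forall>w\<in>W'. \<forall>w'\<in>W'. w \<noteq> w' \<longrightarrow> hd (snd w) = hd (snd w') \<longrightarrow> body w \<inter> body w' = {}"
    using conjunct2[OF conjunct2[OF conjunct2[OF W]]] assms(2) by (meson subsetD)
qed

lemma card_body_le:
  assumes "absorber_family V E s l W" "w \<in> W"
  shows "card (body w) \<le> 2 * l" "finite (body w)"
proof -
  obtain h t where w: "w = (h, t)" by (cases w)
  have "card (body w) \<le> card (set (butlast h)) + card (set (tl t))"
    unfolding body_def w by (simp add: card_Un_le)
  also have "\<dots> \<le> length (butlast h) + length (tl t)" by (intro add_mono card_length)
  also have "\<dots> \<le> 2 * l" using absorber_familyD(8,9)[OF assms(1), of h t] assms(2) w by auto
  finally show "card (body w) \<le> 2 * l" .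
  show "finite (body w)" by (simp add: body_def)
qed

lemma absorber_set_eq:
  assumes "absorber_family V E s l W" "(h, t) \<in> W"
  shows "set h = insert (hd t) (set (butlast h))" "set t = insert (hd t) (set (tl t))"
    "hd t \<notin> body (h, t)" "set (butlast h) \<inter> set (tl t) = {}" "distinct h" "distinct t"
proof -
  note W = absorber_familyD[OF assms(1)]
  have h: "h = butlast h @ [hd t]" and t: "t = hd t # tl t"
    using W(2-4)[OF assms(2)] by (metis append_butlast_last_id, simp)
  have d: "distinct (butlast h @ [hd t] @ tl t)" using W(5)[OF assms(2)] h by (metis append.assoc)
  show "set h = insert (hd t) (set (butlast h))" by (subst h) auto
  show "set t = insert (hd t) (set (tl t))" by (subst t) auto
  show "hd t \<notin> body (h, t)" "set (butlast h) \<inter> set (tl t) = {}" using d by (auto simp: body_def)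
  show "distinct h" by (subst h) (use d in auto)
  show "distinct t" by (subst t) (use d in auto)
qed

lemma absorber_arcs_out_le_one:
  assumes "absorber_family V E s l W" "w \<in> W"
  shows "card {u. (v, u) \<in> absorber_arcs w} \<le> 1" "card {u. (u, v) \<in> absorber_arcs w} \<le> 1"
proof -
  obtain h t where w: "w = (h, t)" by (cases w)
  note W = absorber_familyD[OF assms(1)]
  have mem: "(h, t) \<in> W" using assms(2) w by simp
  have arcs: "absorber_arcs w = path_arcs (h @ tl t)"
    unfolding absorber_arcs_def w using path_arcs_glue[OF W(2-4)[OF mem]] by simp
  have d: "distinct (h @ tl t)" using W(5)[OF mem] .
  have le_one: "card A \<le> 1" if A: "\<And>a b. a \<in> A \<Longrightarrow> b \<in> A \<Longrightarrow> a = b" for A :: "'a set"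
  proof (cases "A = {}")
    case False
    then obtain a where "a \<in> A" by blast
    then have "A = {a}" using A by blast
    then show ?thesis by simp
  qed simp
  show "card {u. (v, u) \<in> absorber_arcs w} \<le> 1"
    by (rule le_one) (use path_arcs_out_unique[OF d] in \<open>auto simp: arcs\<close>)
  show "card {u. (u, v) \<in> absorber_arcs w} \<le> 1"
    by (rule le_one) (use path_arcs_in_unique[OF d] in \<open>auto simp: arcs\<close>)
qed

lemma absorber_arcs_vertices:
  assumes "absorber_family V E s l W" "w \<in> W" "(u, v) \<in> absorber_arcs w"
  shows "u = hd (snd w) \<or> u \<in> body w" "v = hd (snd w) \<or> v \<in> body w"
proof -
  obtain h t where w: "w = (h, t)" by (cases w)
  have "(u, v) \<in> set h \<times> set h \<union> set t \<times> set t"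
    using assms(3) path_arcs_subset_set[of h] path_arcs_subset_set[of t] unfolding absorber_arcs_def w by auto
  then show "u = hd (snd w) \<or> u \<in> body w" "v = hd (snd w) \<or> v \<in> body w"
    using absorber_set_eq(1,2)[OF assms(1) assms(2)[unfolded w]] unfolding w body_def by auto
qed

text \<open>A maximal family in which every vertex is the centre of at most \<open>N\<close> absorbers and lies in the body
  of at most \<open>U\<close> of them has exactly \<open>N\<close> absorbers at every centre: as \<open>card W \<le> card V * N\<close>, at most
  \<open>U\<close> vertices are used up, and avoiding them still allows another absorber.\<close>

lemma absorber_family_exists:
  assumes V: "finite V" "E \<subseteq> V \<times> V"
    and tour: "\<And>u v. u \<in> V \<Longrightarrow> v \<in> V \<Longrightarrow> u \<noteq> v \<Longrightarrow> (u, v) \<in> E \<longleftrightarrow> (v, u) \<notin> E"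
    and U: "1 \<le> U" "2 * l * (card V * N) \<le> U * U" "2 * U + N + 2 * l * N + l < s"
    and l: "card V \<le> 2 ^ l"
    and high: "3 * s \<le> card {v \<in> V. int s \<le> arc_excess E v}"
    and low: "3 * s \<le> card {v \<in> V. arc_excess E v \<le> - int s}"
  obtains W where "absorber_family V E s l W"
    "\<And>x. x \<in> V \<Longrightarrow> card {w \<in> W. hd (snd w) = x} = N"
    "\<And>v. card {w \<in> W. v \<in> body w} \<le> U"
    "\<And>w. w \<in> W \<Longrightarrow> hd (snd w) \<in> V"
proof -
  let ?Q = "\<lambda>W. absorber_family V E s l W \<and> (\<forall>x. card {w \<in> W. hd (snd w) = x} \<le> N) \<and>
     (\<forall>v. card {w \<in> W. v \<in> body w} \<le> U)"
  have centre: "hd (snd w) \<in> V" if "absorber_family V E s l W" "w \<in> W" for W w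
  proof -
    have "(fst w, snd w) \<in> W" using that(2) by simp
    note absorber_familyD(3,6)[OF that(1) this]
    then show ?thesis using hd_in_set[of "snd w"] by blast
  qed
  have size: "card W = (\<Sum>x\<in>V. card {w \<in> W. hd (snd w) = x})" if F: "absorber_family V E s l W" for W
  proof -
    have fin: "finite W" using absorber_familyD(1)[OF F] .
    have "W = (\<Union>x\<in>V. {w \<in> W. hd (snd w) = x})" using centre[OF F] by blast
    then have "card W = card (\<Union>x\<in>V. {w \<in> W. hd (snd w) = x})" by (rule arg_cong)
    also have "\<dots> = (\<Sum>x\<in>V. card {w \<in> W. hd (snd w) = x})"
      using V(1) fin by (intro card_UN_disjoint) auto
    finally show ?thesis .
  qed
  have size_le: "card W \<le> card V * N" if "?Q W" for W
  proof -
    have "(\<Sum>x\<in>V. card {w \<in> W. hd (snd w) = x}) \<le> (\<Sum>x\<in>V. N)" using that by (intro sum_mono) auto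
    then show ?thesis using size that by simp
  qed
  have "\<exists>W. ?Q W \<and> (\<forall>W'. ?Q W' \<longrightarrow> card W' \<le> card W)"
  proof (rule ex_has_greatest_nat[of ?Q "{}" card "card V * N + 1"])
    show "?Q {}" by (simp add: absorber_family_def disjoint_family_on_def)
    show "\<forall>W. ?Q W \<longrightarrow> card W < card V * N + 1" using size_le by (simp add: le_imp_less_Suc)
  qed
  then obtain W where W: "?Q W" and Wmax: "\<And>W'. ?Q W' \<Longrightarrow> card W' \<le> card W" by blast
  have WF: "absorber_family V E s l W" using W by blast
  note WD = absorber_familyD[OF WF]
  have "card {w \<in> W. hd (snd w) = x} = N" if x: "x \<in> V" for x
  proof (rule ccontr)
    assume "card {w \<in> W. hd (snd w) = x} \<noteq> N"
    then have lessN: "card {w \<in> W. hd (snd w) = x} < N" using W by (simp add: order_less_le)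
    define Z where "Z = (\<Union>w\<in>W. absorber_arcs w)"
    define Full where "Full = {v \<in> V. U \<le> card {w \<in> W. v \<in> body w}}"
    define Near where "Near = (\<Union>w\<in>{w \<in> W. hd (snd w) = x}. body w)"
    have finFull: "finite Full" using V(1) by (simp add: Full_def)
    have cardFull: "card Full \<le> U"
    proof -
      \<comment> \<open>Pairs of a full vertex and an absorber through it are counted twice; a body
        has at most \<open>2 * l\<close> vertices.\<close>
      have "U * card Full = (\<Sum>v\<in>Full. U)" by simp
      also have "\<dots> \<le> (\<Sum>v\<in>Full. card {w \<in> W. v \<in> body w})" by (rule sum_mono) (simp add: Full_def)
      also have "\<dots> = (\<Sum>w\<in>W. card {v \<in> Full. v \<in> body w})"
        using finFull WD(1) by (rule sum_multicount_gen) simp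
      also have "\<dots> \<le> (\<Sum>w\<in>W. 2 * l)"
      proof (rule sum_mono)
        fix w assume w: "w \<in> W"
        have "card {v \<in> Full. v \<in> body w} \<le> card (body w)"
          using card_body_le(2)[OF WF w] by (intro card_mono) auto
        then show "card {v \<in> Full. v \<in> body w} \<le> 2 * l" using card_body_le(1)[OF WF w] by simp
      qed
      also have "\<dots> = 2 * l * card W" by simp
      also have "\<dots> \<le> 2 * l * (card V * N)" using size_le[OF W] by (rule mult_le_mono2)
      also have "\<dots> \<le> U * U" by (rule U(2))
      finally show ?thesis using U(1) by simp
    qed
    have finNear: "finite Near"
      unfolding Near_def using WD(1) card_body_le(2)[OF WF] by auto
    have cardNear: "card Near \<le> 2 * l * N"
    proof -
      have "card Near \<le> (\<Sum>w\<in>{w \<in> W. hd (snd w) = x}. card (body w))"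
        unfolding Near_def using WD(1) by (intro card_UN_le) auto
      also have "\<dots> \<le> (\<Sum>w\<in>{w \<in> W. hd (snd w) = x}. 2 * l)"
        by (rule sum_mono) (use card_body_le(1)[OF WF] in auto)
      also have "\<dots> = 2 * l * card {w \<in> W. hd (snd w) = x}" by simp
      also have "\<dots> \<le> 2 * l * N" using lessN by (intro mult_le_mono2) simp
      finally show ?thesis .
    qed
    \<comment> \<open>An absorber is one path and takes at most one entering and one leaving arc at
      a vertex. So this also bounds the arcs of \<open>Z\<close> at \<open>v\<close> in each
      direction, which is the \<open>d\<close> of the path lemmas.\<close>
    have used: "card {w \<in> W. v = hd (snd w) \<or> v \<in> body w} \<le> N + U" for v
    proof -
      have eq: "{w \<in> W. v = hd (snd w) \<or> v \<in> body w} = {w \<in> W. hd (snd w) = v} \<union> {w \<in> W. v \<in> body w}" by auto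
      have "card {w \<in> W. v = hd (snd w) \<or> v \<in> body w} \<le> card {w \<in> W. hd (snd w) = v} + card {w \<in> W. v \<in> body w}"
        by (subst eq) (rule card_Un_le)
      also have "\<dots> \<le> N + U" using W by (intro add_mono) auto
      finally show ?thesis .
    qed
    have used_arcs: "card (\<Union>w\<in>{w \<in> W. v = hd (snd w) \<or> v \<in> body w}. f w) \<le> N + U"
      if "\<And>w. w \<in> W \<Longrightarrow> card (f w) \<le> 1" for v :: 'a and f :: "'a list \<times> 'a list \<Rightarrow> 'a set"
    proof -
      have "card (\<Union>w\<in>{w \<in> W. v = hd (snd w) \<or> v \<in> body w}. f w) \<le> (\<Sum>w\<in>{w \<in> W. v = hd (snd w) \<or> v \<in> body w}. card (f w))"
        using WD(1) by (intro card_UN_le) auto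
      also have "\<dots> \<le> (\<Sum>w\<in>{w \<in> W. v = hd (snd w) \<or> v \<in> body w}. 1)"
        by (rule sum_mono) (use that in auto)
      also have "\<dots> \<le> N + U" using used[of v] by simp
      finally show ?thesis .
    qed
    have finarcs: "finite (absorber_arcs w)" for w :: "'a list \<times> 'a list" by (simp add: absorber_arcs_def)
    have fin1: "finite {u. (u, v) \<in> absorber_arcs w}" "finite {u. (v, u) \<in> absorber_arcs w}" for v and w :: "'a list \<times> 'a list"
      by (rule finite_subset[OF _ finite_imageI[OF finarcs[of w], of fst]], force)
        (rule finite_subset[OF _ finite_imageI[OF finarcs[of w], of snd]], force)
    have inZ: "card {u. (u, v) \<in> E \<inter> Z} \<le> N + U" for v
    proof -
      have "{u. (u, v) \<in> E \<inter> Z} \<subseteq> (\<Union>w\<in>{w \<in> W. v = hd (snd w) \<or> v \<in> body w}. {u. (u, v) \<in> absorber_arcs w})"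
        unfolding Z_def using absorber_arcs_vertices(2)[OF WF] by fast
      then have "card {u. (u, v) \<in> E \<inter> Z} \<le> card (\<Union>w\<in>{w \<in> W. v = hd (snd w) \<or> v \<in> body w}. {u. (u, v) \<in> absorber_arcs w})"
        using WD(1) fin1 by (intro card_mono) auto
      also have "\<dots> \<le> N + U" by (rule used_arcs) (use absorber_arcs_out_le_one(2)[OF WF] in auto)
      finally show ?thesis .
    qed
    have outZ: "card {u. (v, u) \<in> E \<inter> Z} \<le> N + U" for v
    proof -
      have "{u. (v, u) \<in> E \<inter> Z} \<subseteq> (\<Union>w\<in>{w \<in> W. v = hd (snd w) \<or> v \<in> body w}. {u. (v, u) \<in> absorber_arcs w})"
        unfolding Z_def using absorber_arcs_vertices(1)[OF WF] by fast
      then have "card {u. (v, u) \<in> E \<inter> Z} \<le> card (\<Union>w\<in>{w \<in> W. v = hd (snd w) \<or> v \<in> body w}. {u. (v, u) \<in> absorber_arcs w})"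
        using WD(1) fin1 by (intro card_mono) auto
      also have "\<dots> \<le> N + U" by (rule used_arcs) (use absorber_arcs_out_le_one(1)[OF WF] in auto)
      finally show ?thesis .
    qed
    \<comment> \<open>Avoiding \<open>Full\<close> preserves the bound \<open>U\<close>, avoiding
      \<open>Near\<close> keeps the bodies at \<open>x\<close> disjoint. The centre \<open>x\<close>
      may itself be full, since centres do not count towards \<open>U\<close>.\<close>
    define F1 where "F1 = (Full \<union> Near) \<inter> V - {x}"
    have F1: "x \<notin> F1" "F1 \<subseteq> V" by (auto simp: F1_def)
    have cardF1: "card F1 \<le> U + 2 * l * N"
    proof -
      have "card F1 \<le> card (Full \<union> Near)"
        unfolding F1_def using finFull finNear by (intro card_mono) auto
      then show ?thesis using card_Un_le[of Full Near] cardFull cardNear by linarith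
    qed
    then have small1: "N + U + card F1 < s" using U(3) by linarith
    obtain h where h: "distinct h" "h \<noteq> []" "last h = x" "int s \<le> arc_excess E (hd h)" "set h \<subseteq> V - F1"
      "path_arcs h \<subseteq> E - Z" "length h \<le> Suc l"
      using short_path_from_high_excess[OF V x F1 tour inZ small1 high l] by blast
    define F2 where "F2 = F1 \<union> set (butlast h)"
    have hx: "h = butlast h @ [x]" using h(2,3) by (metis append_butlast_last_id)
    have xb: "x \<notin> set (butlast h)"
    proof -
      have "distinct (butlast h @ [x])" using h(1) hx by metis
      then show ?thesis by simp
    qed
    have F2: "x \<notin> F2" "F2 \<subseteq> V" using F1 xb h(5) by (auto simp: F2_def dest: in_set_butlastD)
    have "card F2 \<le> card F1 + length (butlast h)"
      unfolding F2_def by (meson card_Un_le card_length add_left_mono order_trans)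
    \<comment> \<open>The budget behind the hypothesis on \<open>s\<close>: \<open>N + U\<close>
      arcs taken at a vertex, \<open>U\<close> full vertices, \<open>2 * l * N\<close> near ones,
      and \<open>l\<close> on the new first half, which the second half must avoid.\<close>
    then have small2: "N + U + card F2 < s" using cardF1 U(3) h(7) by simp
    obtain t where t: "distinct t" "t \<noteq> []" "hd t = x" "arc_excess E (last t) \<le> - int s" "set t \<subseteq> V - F2"
      "path_arcs t \<subseteq> E - Z" "length t \<le> Suc l"
      using short_path_to_low_excess[OF V x F2 tour outZ small2 low l] by blast
    let ?w = "(h, t)"
    have tx: "t = x # tl t" using t(2,3) by (cases t) auto
    have xt: "x \<notin> set (tl t)"
    proof -
      have "distinct (x # tl t)" using t(1) tx by metis
      then show ?thesis by simp
    qed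
    have bodyV: "body ?w \<subseteq> V - F1 - {x}"
      using h(5) t(5) xb xt t(2) unfolding body_def F2_def by (auto dest: in_set_butlastD list.set_sel(2))
    have distht: "distinct (h @ tl t)"
    proof -
      have "set (tl t) \<inter> set (butlast h) = {}" using t(2,5) unfolding F2_def by (auto dest: list.set_sel(2))
      moreover have "set h = insert x (set (butlast h))" by (subst hx) auto
      ultimately show ?thesis using h(1) t(1) xt by (auto simp: distinct_tl)
    qed
    have arcsw: "absorber_arcs ?w \<inter> Z = {}" using h(6) t(6) by (auto simp: absorber_arcs_def)
    have body_new: "body ?w \<inter> body w = {}" if "w \<in> W" "hd (snd w) = x" for w
      using bodyV that unfolding F1_def Near_def by blast
    \<comment> \<open>If it were already present, its body would be disjoint from itself, hence
      empty; both halves would be trivial and \<open>x\<close> of excess at least \<open>s\<close>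
      and at most \<open>- s\<close>.\<close>
    have wW: "?w \<notin> W"
    proof
      assume "?w \<in> W"
      then have "body ?w = {}" using body_new[of ?w] t(3) by auto
      then have "butlast h = []" "tl t = []" by (auto simp: body_def)
      then have "hd h = x" "last t = x" using hx tx by (metis append_Nil list.sel(1), metis last.simps)
      then show False using h(4) t(4) U by simp
    qed
    have F: "absorber_family V E s l (insert ?w W)"
      unfolding absorber_family_def
    proof (intro conjI ballI)
      show "finite (insert ?w W)" using WD(1) by simp
      fix w assume "w \<in> insert ?w W"
      then show "case w of (h, t) \<Rightarrow> h \<noteq> [] \<and> t \<noteq> [] \<and> last h = hd t \<and> distinct (h @ tl t) \<and> set h \<union> set t \<subseteq> V \<and>
        path_arcs h \<union> path_arcs t \<subseteq> E \<and> length h \<le> Suc l \<and> length t \<le> Suc l \<and>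
        int s \<le> arc_excess E (hd h) \<and> arc_excess E (last t) \<le> - int s"
      proof
        assume "w = ?w"
        have "last h = hd t" using trans[OF h(3) t(3)[symmetric]] .
        moreover have "set h \<union> set t \<subseteq> V" "path_arcs h \<union> path_arcs t \<subseteq> E"
          using h(5,6) t(5,6) by blast+
        ultimately have "last h = hd t" "set h \<union> set t \<subseteq> V" "path_arcs h \<union> path_arcs t \<subseteq> E"
          by blast+
        then show ?thesis using \<open>w = ?w\<close> h(2,4,7) t(2,4,7) distht by simp
      next
        assume "w \<in> W"
        then show ?thesis by (rule bspec[OF conjunct1[OF conjunct2[OF WF[unfolded absorber_family_def]]]])
      qed
    next
      show "disjoint_family_on absorber_arcs (insert ?w W)"
        unfolding disjoint_family_on_def
      proof (intro ballI impI)
        fix w w' assume w: "w \<in> insert ?w W" "w' \<in> insert ?w W" "w \<noteq> w'"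
        have "absorber_arcs v \<inter> absorber_arcs ?w = {}" if "v \<in> W" for v
          using arcsw that unfolding Z_def by blast
        then show "absorber_arcs w \<inter> absorber_arcs w' = {}"
          using w WD(12)[of w w'] by (metis disjoint_iff insert_iff)
      qed
    next
      show "w \<noteq> w' \<longrightarrow> hd (snd w) = hd (snd w') \<longrightarrow> body w \<inter> body w' = {}"
        if mem: "w \<in> insert ?w W" "w' \<in> insert ?w W" for w w'
      proof (intro impI)
        assume ne: "w \<noteq> w'" and hd: "hd (snd w) = hd (snd w')"
        consider "w \<in> W" "w' \<in> W" | "w = ?w" "w' \<in> W" | "w \<in> W" "w' = ?w" using mem ne by blast
        then show "body w \<inter> body w' = {}"
        proof cases
          case 1
          then show ?thesis using WD(13)[of w w'] ne hd by blast
        next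
          case 2
          then show ?thesis using body_new[of w'] hd t(3) by simp
        next
          case 3
          then show ?thesis using body_new[of w] hd t(3) by (simp add: Int_commute)
        qed
      qed
    qed
    have "card {w \<in> insert ?w W. hd (snd w) = y} \<le> N" for y
    proof (cases "y = x")
      case True
      then have "{w \<in> insert ?w W. hd (snd w) = y} = insert ?w {w \<in> W. hd (snd w) = x}" using t(3) by auto
      then show ?thesis using lessN wW WD(1) by simp
    next
      case False
      then have "{w \<in> insert ?w W. hd (snd w) = y} = {w \<in> W. hd (snd w) = y}" using t(3) by auto
      then show ?thesis using W by metis
    qed
    moreover have "card {w \<in> insert ?w W. v \<in> body w} \<le> U" for v
    proof (cases "v \<in> body ?w")
      case True
      then have "v \<notin> Full" using bodyV unfolding F1_def by blast
      then have "card {w \<in> W. v \<in> body w} < U" using True bodyV by (auto simp: Full_def not_le)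
      moreover have "{w \<in> insert ?w W. v \<in> body w} = insert ?w {w \<in> W. v \<in> body w}" using True by auto
      ultimately show ?thesis using wW WD(1) by simp
    next
      case False
      then have "{w \<in> insert ?w W. v \<in> body w} = {w \<in> W. v \<in> body w}" by auto
      then show ?thesis using W by metis
    qed
    ultimately have "card (insert ?w W) \<le> card W" using F by (intro Wmax) blast
    then show False using wW WD(1) by simp
  qed
  then show thesis using that[OF WF] W centre[OF WF] by blast
qed

section \<open>Absorption\<close>

text \<open>The smaller set is injected into the larger. Applied to the ends and starts of paths at
  one vertex, it pairs them until one kind is exhausted.\<close>

lemma partial_matching:
  assumes "finite A" "finite B"
  shows "\<exists>M. M \<subseteq> A \<times> B \<and> inj_on fst M \<and> inj_on snd M \<and> card M \<le> min (card A) (card B) \<and>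
           (fst ` M = A \<or> snd ` M = B)"
proof (cases "card A \<le> card B")
  case True
  then obtain f where "inj_on f A" "f ` A \<subseteq> B" using inj_on_iff_card_le[OF assms] by blast
  then show ?thesis
    using True assms card_image_le[OF assms(1), of "\<lambda>a. (a, f a)"]
    by (intro exI[of _ "(\<lambda>a. (a, f a)) ` A"]) (auto simp: inj_on_def image_image)
next
  case False
  then obtain f where "inj_on f B" "f ` B \<subseteq> A" using inj_on_iff_card_le[OF assms(2,1)] by auto
  then show ?thesis
    using False assms card_image_le[OF assms(2), of "\<lambda>a. (f a, a)"]
    by (intro exI[of _ "(\<lambda>b. (f b, b)) ` B"]) (auto simp: inj_on_def image_image)
qed

text \<open>A pair \<open>j\<close> in \<open>J\<close> is an end of \<open>fst j\<close> to be
  continued and a start of \<open>snd j\<close> to be preceded, both at the centre of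
  \<open>g j\<close>. Absorbers are chosen greedily: at a centre fewer than \<open>r\<close> are
  taken, and at most \<open>2 * m + 2 * l\<close> meet the two paths or the halves already attached
  to their other ends.\<close>

lemma absorber_assignment:
  assumes W: "absorber_family V E s l W"
    and J: "finite J" "inj_on fst J" "inj_on snd J"
    and short: "\<And>j. j \<in> J \<Longrightarrow> length (fst j) \<le> m \<and> length (snd j) \<le> m"
    and neq: "\<And>j. j \<in> J \<Longrightarrow> fst j \<noteq> snd j"
    and few: "\<And>v. card {j \<in> J. last (fst j) = v} \<le> r"
    and avail: "\<And>j. j \<in> J \<Longrightarrow> card {w \<in> W. hd (snd w) = last (fst j)} = N"
    and N: "r + 2 * m + 2 * l \<le> N"
  obtains g where "inj_on g J" "\<And>j. j \<in> J \<Longrightarrow> g j \<in> W" "\<And>j. j \<in> J \<Longrightarrow> hd (snd (g j)) = last (fst j)"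
    "\<And>j. j \<in> J \<Longrightarrow> set (tl (snd (g j))) \<inter> set (fst j) = {}"
    "\<And>j. j \<in> J \<Longrightarrow> set (butlast (fst (g j))) \<inter> set (snd j) = {}"
    "\<And>i j. i \<in> J \<Longrightarrow> j \<in> J \<Longrightarrow> snd i = fst j \<Longrightarrow> set (butlast (fst (g i))) \<inter> set (tl (snd (g j))) = {}"
proof -
  note WD = absorber_familyD[OF W]
  let ?ok = "\<lambda>K g. inj_on g K \<and> (\<forall>j\<in>K. g j \<in> W \<and> hd (snd (g j)) = last (fst j) \<and>
      set (tl (snd (g j))) \<inter> set (fst j) = {} \<and> set (butlast (fst (g j))) \<inter> set (snd j) = {}) \<and>
      (\<forall>i\<in>K. \<forall>j\<in>K. snd i = fst j \<longrightarrow> set (butlast (fst (g i))) \<inter> set (tl (snd (g j))) = {})"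
  have "\<exists>g. ?ok K g" if "finite K" "K \<subseteq> J" for K
    using that
  proof (induction K rule: finite_induct)
    case empty
    then show ?case by simp
  next
    case (insert j0 K)
    have "\<exists>g. ?ok K g" by (rule insert.IH) (use insert.prems in simp)
    then obtain g where g: "?ok K g" by (rule exE)
    have j0: "j0 \<in> J" and KJ: "K \<subseteq> J" using insert.prems by auto
    define x where "x = last (fst j0)"
    \<comment> \<open>Earlier pairs that have already extended \<open>snd j0\<close> at its end,
      respectively \<open>fst j0\<close> at its start. By injectivity there is at most one of each,
      so the halves to be avoided have at most \<open>2 * l\<close> vertices outside their
      centres.\<close>
    define K1 where "K1 = {j \<in> K. fst j = snd j0}"
    define K2 where "K2 = {i \<in> K. snd i = fst j0}"
    have finK: "finite K1" "finite K2" using insert.hyps(1) by (auto simp: K1_def K2_def)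
    have "inj_on fst K1" "inj_on snd K2"
      using J(2,3) KJ unfolding K1_def K2_def by (auto intro: inj_on_subset)
    moreover have "fst ` K1 \<subseteq> {snd j0}" "snd ` K2 \<subseteq> {fst j0}" by (auto simp: K1_def K2_def)
    ultimately have K_le: "card K1 \<le> 1" "card K2 \<le> 1"
      using card_inj_on_le[of fst K1 "{snd j0}"] card_inj_on_le[of snd K2 "{fst j0}"] by auto
    define F where "F = set (fst j0) \<union> set (snd j0) \<union> (\<Union>j\<in>K1. set (tl (snd (g j)))) \<union>
        (\<Union>i\<in>K2. set (butlast (fst (g i))))"
    have finF: "finite F" using finK by (simp add: F_def)
    have lens: "length (tl (snd (g j))) \<le> l" "length (butlast (fst (g j))) \<le> l" if "j \<in> K" for j
    proof -
      have "(fst (g j), snd (g j)) \<in> W" using g that by simp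
      from WD(8,9)[OF this] show "length (tl (snd (g j))) \<le> l" "length (butlast (fst (g j))) \<le> l" by simp_all
    qed
    have "card (\<Union>j\<in>K1. set (tl (snd (g j)))) \<le> (\<Sum>j\<in>K1. l)"
      using lens by (intro order_trans[OF card_UN_le[OF finK(1)] sum_mono])
        (auto simp: K1_def intro: order_trans[OF card_length])
    also have "\<dots> \<le> l" using K_le(1) by simp
    finally have F1: "card (\<Union>j\<in>K1. set (tl (snd (g j)))) \<le> l" .
    have "card (\<Union>j\<in>K2. set (butlast (fst (g j)))) \<le> (\<Sum>j\<in>K2. l)"
      using lens by (intro order_trans[OF card_UN_le[OF finK(2)] sum_mono])
        (auto simp: K2_def intro: order_trans[OF card_length])
    also have "\<dots> \<le> l" using K_le(2) by simp
    finally have F2: "card (\<Union>j\<in>K2. set (butlast (fst (g j)))) \<le> l" .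
    have F3: "card (set (fst j0)) \<le> m" "card (set (snd j0)) \<le> m"
      using short[OF j0] card_length[of "fst j0"] card_length[of "snd j0"] by linarith+
    have un4: "card (A \<union> B \<union> C \<union> D) \<le> card A + card B + card C + card D" for A B C D :: "'a set"
      by (meson add_le_mono card_Un_le le_trans order_refl)
    have cardF: "card F \<le> m + m + l + l"
      unfolding F_def using un4[of "set (fst j0)" "set (snd j0)"] F1 F2 F3
      by (meson add_le_mono order_trans)
    define A where "A = {w \<in> W. hd (snd w) = x}"
    have finA: "finite A" using WD(1) by (simp add: A_def)
    define Used where "Used = g ` {j \<in> K. last (fst j) = x}"
    define Hit where "Hit = {w \<in> A. body w \<inter> F \<noteq> {}}"
    have "card Used \<le> card {j \<in> K. last (fst j) = x}"
      unfolding Used_def using insert.hyps(1) by (intro card_image_le) simp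
    also have "\<dots> < card {j \<in> J. last (fst j) = x}"
      by (rule psubset_card_mono) (use J(1) KJ insert.hyps(2) j0 in \<open>auto simp: x_def\<close>)
    also have "\<dots> \<le> r" by (rule few)
    finally have cardUsed: "card Used < r" .
    \<comment> \<open>Bodies at the same centre are disjoint, so each vertex of \<open>F\<close>
      spoils at most one absorber.\<close>
    have cardHit: "card Hit \<le> card F"
    proof -
      define f where "f w = (SOME a. a \<in> body w \<inter> F)" for w
      have f: "f w \<in> body w \<inter> F" if "w \<in> Hit" for w
      proof -
        have "\<exists>a. a \<in> body w \<inter> F" using that by (auto simp: Hit_def)
        then show ?thesis unfolding f_def by (rule someI_ex)
      qed
      have "inj_on f Hit"
      proof (rule inj_onI)
        fix w w' assume ww: "w \<in> Hit" "w' \<in> Hit" "f w = f w'"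
        then have "w \<in> W" "w' \<in> W" "hd (snd w) = hd (snd w')" by (auto simp: Hit_def A_def)
        moreover have "f w \<in> body w" "f w \<in> body w'" using f[OF ww(1)] f[OF ww(2)] ww(3) by auto
        ultimately show "w = w'" by (rule WD(13))
      qed
      moreover have "f ` Hit \<subseteq> F" using f by blast
      ultimately show ?thesis using finF by (meson card_inj_on_le)
    qed
    have "card (Used \<union> Hit) < card A"
    proof -
      have "card A = N" using avail[OF j0] by (simp add: A_def x_def)
      then show ?thesis using card_Un_le[of Used Hit] cardUsed cardHit cardF N by linarith
    qed
    moreover have "finite (Used \<union> Hit)" using finA insert.hyps(1) by (simp add: Used_def Hit_def)
    ultimately obtain w where w: "w \<in> A" "w \<notin> Used" "w \<notin> Hit"
      by (metis UnCI card_mono linorder_not_less subsetI)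
    have wW: "w \<in> W" "hd (snd w) = x" and wF: "body w \<inter> F = {}" using w by (auto simp: A_def Hit_def)
    let ?g = "g(j0 := w)"
    have new: "w \<noteq> g j" if "j \<in> K" for j
      using that w(2) g wW(2) unfolding Used_def by auto
    have old: "?g j = g j" if "j \<in> K" for j using that insert.hyps(2) by auto
    have "?ok (insert j0 K) ?g"
    proof (intro conjI ballI impI)
      show "inj_on ?g (insert j0 K)"
        using g new insert.hyps(2) by (auto simp: inj_on_def)
      fix j assume j: "j \<in> insert j0 K"
      show "?g j \<in> W" "hd (snd (?g j)) = last (fst j)"
        using j g wW by (auto simp: x_def)
      show "set (tl (snd (?g j))) \<inter> set (fst j) = {}"
        using j g wF by (cases "j = j0") (auto simp: body_def F_def)
      show "set (butlast (fst (?g j))) \<inter> set (snd j) = {}"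
        using j g wF by (cases "j = j0") (auto simp: body_def F_def)
      fix i assume i: "i \<in> insert j0 K" and c: "snd j = fst i"
      consider "j \<in> K" "i \<in> K" | "j = j0" "i \<in> K" | "j \<in> K" "i = j0" | "j = j0" "i = j0"
        using i j by blast
      then show "set (butlast (fst (?g j))) \<inter> set (tl (snd (?g i))) = {}"
      proof cases
        case 1
        then show ?thesis using g c old by simp
      next
        case 2
        then have "i \<in> K1" using c by (simp add: K1_def)
        then show ?thesis using wF old[OF 2(2)] 2(1) unfolding body_def F_def by auto
      next
        case 3
        then have "j \<in> K2" using c by (simp add: K2_def)
        then show ?thesis using wF old[OF 3(1)] 3(2) unfolding body_def F_def by auto
      next
        case 4
        then show ?thesis using neq[OF j0] c by simp
      qed
    qed
    then show ?case by (rule exI[of "?ok (insert j0 K)" ?g])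
  qed
  from this[OF J(1) subset_refl] obtain g where g: "?ok J g" by (rule exE)
  show thesis
  proof (rule that[of g])
    show "inj_on g J" by (rule conjunct1[OF g])
    fix j assume "j \<in> J"
    note gj = bspec[OF conjunct1[OF conjunct2[OF g]] this]
    show "g j \<in> W" by (rule conjunct1[OF gj])
    show "hd (snd (g j)) = last (fst j)" by (rule conjunct1[OF conjunct2[OF gj]])
    show "set (tl (snd (g j))) \<inter> set (fst j) = {}" by (rule conjunct1[OF conjunct2[OF conjunct2[OF gj]]])
    show "set (butlast (fst (g j))) \<inter> set (snd j) = {}" by (rule conjunct2[OF conjunct2[OF conjunct2[OF gj]]])
  next
    fix i j assume "i \<in> J" "j \<in> J" "snd i = fst j"
    then show "set (butlast (fst (g i))) \<inter> set (tl (snd (g j))) = {}"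
      using conjunct2[OF conjunct2[OF g]] by blast
  qed
qed

text \<open>Positive \<open>s\<close> separates the first vertex of an absorber from the last, so
  even one with a trivial half has an arc. This serves for the absorbers left whole and, in
  computing excesses, for all of them.\<close>

lemma absorber_path_partition:
  assumes W: "absorber_family V E s l W" and s: "0 < s"
  shows "path_partition (\<Union>w\<in>W. absorber_arcs w) ((\<lambda>w. fst w @ tl (snd w)) ` W)"
proof -
  note WD = absorber_familyD[OF W]
  have arcs: "path_arcs (fst w @ tl (snd w)) = absorber_arcs w" if "w \<in> W" for w
  proof -
    have "(fst w, snd w) \<in> W" using that by simp
    from path_arcs_glue[OF WD(2-4)[OF this]] show ?thesis by (simp add: absorber_arcs_def)
  qed
  show ?thesis
    unfolding path_partition_def
  proof (intro conjI ballI)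
    show "finite ((\<lambda>w. fst w @ tl (snd w)) ` W)" using WD(1) by simp
    show "(\<Union>p\<in>(\<lambda>w. fst w @ tl (snd w)) ` W. path_arcs p) = (\<Union>w\<in>W. absorber_arcs w)"
      using arcs by simp
    show "disjoint_family_on path_arcs ((\<lambda>w. fst w @ tl (snd w)) ` W)"
      unfolding disjoint_family_on_def
    proof (intro ballI impI)
      fix p q assume "p \<in> (\<lambda>w. fst w @ tl (snd w)) ` W" "q \<in> (\<lambda>w. fst w @ tl (snd w)) ` W" "p \<noteq> q"
      then obtain w w' where "w \<in> W" "w' \<in> W" "p = fst w @ tl (snd w)" "q = fst w' @ tl (snd w')" "w \<noteq> w'" by blast
      then show "path_arcs p \<inter> path_arcs q = {}" using arcs WD(12)[of w w'] by (metis disjoint_iff)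
    qed
    fix p assume "p \<in> (\<lambda>w. fst w @ tl (snd w)) ` W"
    then obtain w where w: "w \<in> W" "p = fst w @ tl (snd w)" by blast
    then have m: "(fst w, snd w) \<in> W" by simp
    show "distinct p" using WD(5)[OF m] w by simp
    have "hd (fst w) \<noteq> last (snd w)" using WD(10,11)[OF m] s by auto
    then show "2 \<le> length p"
      using WD(2-4)[OF m] w by (cases "fst w"; cases "tl (fst w)"; cases "snd w"; cases "tl (snd w)") auto
  qed
qed

text \<open>After the joins every start is the first vertex of an absorber, of excess at least
  \<open>s\<close>, or an unpaired start of \<open>S\<close>; ends are symmetric. Unpaired starts
  and unpaired ends never share a vertex, nor do high and low excess. An unpaired start at
  \<open>v\<close> means \<open>starts S v > ends S v\<close>; as at most \<open>s\<close> absorbers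
  end at \<open>v\<close>, its excess is above \<open>- s\<close>, so in fact none ends there. The
  remaining case is symmetric.\<close>

lemma absorb:
  assumes W: "absorber_family V E s l W" and s: "0 < s"
    and V: "finite V" "E \<subseteq> V \<times> V"
    and avail: "\<And>x. x \<in> V \<Longrightarrow> card {w \<in> W. hd (snd w) = x} = N"
    and first: "\<And>v. card {w \<in> W. hd (fst w) = v} \<le> s"
    and last: "\<And>v. card {w \<in> W. last (snd w) = v} \<le> s"
    and S: "path_partition (E - (\<Union>w\<in>W. absorber_arcs w)) S"
    and short: "\<And>p. p \<in> S \<Longrightarrow> length p \<le> m"
    and few: "\<And>v. min (starts S v) (ends S v) \<le> r"
    and N: "r + 2 * m + 2 * l \<le> N"
  shows "\<exists>Q. path_partition E Q \<and> (\<forall>v. starts Q v = 0 \<or> ends Q v = 0)"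
proof -
  note WD = absorber_familyD[OF W]
  note SD = path_partitionD[OF S]
  define Z where "Z = (\<Union>w\<in>W. absorber_arcs w)"
  have ZE: "Z \<subseteq> E" using WD(7) unfolding Z_def absorber_arcs_def by fastforce
  have finE: "finite E" using V by (meson finite_SigmaI finite_subset)
  have hdV: "hd p \<in> V" if p: "p \<in> S" for p
  proof -
    obtain a b q where "p = a # b # q" using SD(3)[OF p] by (metis Suc_le_length_iff numeral_2_eq_2)
    then show ?thesis using SD(5)[OF p] V(2) by auto
  qed
  have "\<forall>v. \<exists>M. M \<subseteq> {p \<in> S. last p = v} \<times> {p \<in> S. hd p = v} \<and> inj_on fst M \<and> inj_on snd M \<and>
      card M \<le> min (ends S v) (starts S v) \<and> (fst ` M = {p \<in> S. last p = v} \<or> snd ` M = {p \<in> S. hd p = v})"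
    unfolding starts_def ends_def using SD(1) by (intro allI partial_matching) auto
  from choice[OF this] obtain M where M0: "\<And>v. M v \<subseteq> {p \<in> S. last p = v} \<times> {p \<in> S. hd p = v} \<and> inj_on fst (M v) \<and>
      inj_on snd (M v) \<and> card (M v) \<le> min (ends S v) (starts S v) \<and>
      (fst ` M v = {p \<in> S. last p = v} \<or> snd ` M v = {p \<in> S. hd p = v})" by (elim exE) iprover
  have M: "\<And>v. M v \<subseteq> {p \<in> S. last p = v} \<times> {p \<in> S. hd p = v}"
    "\<And>v. inj_on fst (M v)" "\<And>v. inj_on snd (M v)" "\<And>v. card (M v) \<le> min (ends S v) (starts S v)"
    "\<And>v. fst ` M v = {p \<in> S. last p = v} \<or> snd ` M v = {p \<in> S. hd p = v}"
    using M0 by iprover+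
  define J where "J = (\<Union>v. M v)"
  have JD: "fst j \<in> S" "snd j \<in> S" "last (fst j) = hd (snd j)" "j \<in> M (last (fst j))" if "j \<in> J" for j
    using that M(1) unfolding J_def by fastforce+
  have "J \<subseteq> S \<times> S" using JD(1,2) by (simp add: subset_iff mem_Times_iff)
  then have finJ: "finite J" using SD(1) by (meson finite_SigmaI finite_subset)
  have inj1: "inj_on fst J"
  proof (rule inj_onI)
    fix i j assume ij: "i \<in> J" "j \<in> J" "fst i = fst j"
    then show "i = j" using JD(4)[of i] JD(4)[of j] M(2)[of "last (fst i)"] by (simp add: inj_on_def)
  qed
  have inj2: "inj_on snd J"
  proof (rule inj_onI)
    fix i j assume ij: "i \<in> J" "j \<in> J" "snd i = snd j"
    then have "last (fst i) = last (fst j)" using JD(3) by metis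
    then show "i = j" using ij JD(4)[of i] JD(4)[of j] M(3)[of "last (fst i)"] by (simp add: inj_on_def)
  qed
  have JM: "{j \<in> J. last (fst j) = v} = M v" for v
    using JD(4) M(1)[of v] unfolding J_def by fastforce
  have Jfew: "card {j \<in> J. last (fst j) = v} \<le> r" for v
    unfolding JM using M(4)[of v] few[of v] by linarith
  have Jneq: "fst j \<noteq> snd j" if "j \<in> J" for j
  proof
    assume eq: "fst j = snd j"
    have "hd (fst j) \<noteq> last (fst j)"
      using SD(2,3)[OF JD(1)[OF that]] by (cases "fst j"; cases "tl (fst j)") auto
    then show False using JD(3)[OF that] eq by simp
  qed
  have Javail: "card {w \<in> W. hd (snd w) = last (fst j)} = N" if "j \<in> J" for j
    using avail hdV JD(2,3)[OF that] by simp
  obtain g where g: "inj_on g J" "\<And>j. j \<in> J \<Longrightarrow> g j \<in> W" "\<And>j. j \<in> J \<Longrightarrow> hd (snd (g j)) = last (fst j)"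
    "\<And>j. j \<in> J \<Longrightarrow> set (tl (snd (g j))) \<inter> set (fst j) = {}"
    "\<And>j. j \<in> J \<Longrightarrow> set (butlast (fst (g j))) \<inter> set (snd j) = {}"
    "\<And>i j. i \<in> J \<Longrightarrow> j \<in> J \<Longrightarrow> snd i = fst j \<Longrightarrow> set (butlast (fst (g i))) \<inter> set (tl (snd (g j))) = {}"
    using absorber_assignment[OF W finJ inj1 inj2 _ Jneq Jfew Javail N] short JD(1,2) by blast
  define hA where "hA j = path_arcs (fst (g j))" for j
  define tA where "tA j = path_arcs (snd (g j))" for j
  have gW: "(fst (g j), snd (g j)) \<in> W" if "j \<in> J" for j using g(2)[OF that] by simp
  have absA: "absorber_arcs (g j) = hA j \<union> tA j" for j by (simp add: absorber_arcs_def hA_def tA_def)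
  have AZ: "hA j \<subseteq> Z" "tA j \<subseteq> Z" if "j \<in> J" for j
    using g(2)[OF that] absA[of j] unfolding Z_def by blast+
  have same: "i = j" if "i \<in> J" "j \<in> J" "e \<in> hA i \<union> tA i" "e \<in> hA j \<union> tA j" for i j e
    using WD(12)[OF g(2)[OF that(1)] g(2)[OF that(2)]] that g(1) unfolding absA inj_on_def by blast
  have hAtA: "hA j \<inter> tA j = {}" if "j \<in> J" for j
  proof (rule ccontr)
    assume "hA j \<inter> tA j \<noteq> {}"
    then obtain u v where uv: "(u, v) \<in> hA j" "(u, v) \<in> tA j" by auto
    note eqs = absorber_set_eq[OF W gW[OF that]]
    have "u \<in> set (butlast (fst (g j)))"
      using path_arcs_fst_butlast[OF uv(1)[unfolded hA_def]] by simp
    moreover have "u \<in> set (snd (g j))"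
      using subsetD[OF path_arcs_subset_set uv(2)[unfolded tA_def]] by simp
    moreover have "hd (snd (g j)) \<notin> set (butlast (fst (g j)))" using eqs(3) by (simp add: body_def)
    ultimately show False using eqs(4) unfolding eqs(2) by (metis IntI empty_iff insertE)
  qed
  \<comment> \<open>The empty list is the default for a path whose start is not paired, so that
    \<open>ext\<close> treats paired and unpaired paths alike.\<close>
  define pre where "pre p = (if p \<in> snd ` J then butlast (fst (g (the_inv_into J snd p))) else [])" for p
  define post where "post p = (if p \<in> fst ` J then tl (snd (g (the_inv_into J fst p))) else [])" for p
  have pre: "pre (snd j) = butlast (fst (g j))" if "j \<in> J" for j
    using that inj2 by (simp add: pre_def the_inv_into_f_f)
  have post: "post (fst j) = tl (snd (g j))" if "j \<in> J" for j
    using that inj1 by (simp add: post_def the_inv_into_f_f)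
  have pre0: "pre p = []" if "p \<notin> snd ` J" for p using that by (simp add: pre_def)
  have post0: "post p = []" if "p \<notin> fst ` J" for p using that by (simp add: post_def)
  define ext where "ext p = pre p @ p @ post p" for p
  \<comment> \<open>By injectivity \<open>p\<close> is the second, respectively first, member of at
    most one pair, so each union is one half of an absorber or empty.\<close>
  define PA where "PA p = (\<Union>j\<in>{j \<in> J. snd j = p}. hA j)" for p
  define QA where "QA p = (\<Union>j\<in>{j \<in> J. fst j = p}. tA j)" for p
  have PA: "PA (snd j) = hA j" if "j \<in> J" for j
  proof -
    have "{i \<in> J. snd i = snd j} = {j}" using that inj2 by (auto dest: inj_onD)
    then show ?thesis by (simp add: PA_def)
  qed
  have QA: "QA (fst j) = tA j" if "j \<in> J" for j
  proof -
    have "{i \<in> J. fst i = fst j} = {j}" using that inj1 by (auto dest: inj_onD)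
    then show ?thesis by (simp add: QA_def)
  qed
  have PA0: "PA p = {}" if "p \<notin> snd ` J" for p using that unfolding PA_def by blast
  have QA0: "QA p = {}" if "p \<notin> fst ` J" for p using that unfolding QA_def by blast
  have ext_post: "path_arcs (p @ post p) = path_arcs p \<union> QA p" if p: "p \<in> S" for p
  proof (cases "p \<in> fst ` J")
    case True
    then obtain j where j: "j \<in> J" "p = fst j" by blast
    show ?thesis
      unfolding j(2) post[OF j(1)] QA[OF j(1)] tA_def
      by (rule path_arcs_glue) (use SD(4)[OF p] j WD(3)[OF gW[OF j(1)]] g(3)[OF j(1)] in auto)
  next
    case False
    then show ?thesis by (simp add: post0 QA0)
  qed
  have ext_arcs: "path_arcs (ext p) = PA p \<union> path_arcs p \<union> QA p" if p: "p \<in> S" for p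
  proof (cases "p \<in> snd ` J")
    case True
    then obtain j where j: "j \<in> J" "p = snd j" by blast
    have "path_arcs (pre p @ (p @ post p)) = hA j \<union> path_arcs (p @ post p)"
      unfolding j(2) pre[OF j(1)] hA_def
      by (rule path_arcs_glue') (use SD(4)[OF p] j WD(2,4)[OF gW[OF j(1)]] g(3)[OF j(1)] JD(3)[OF j(1)] in auto)
    then show ?thesis using ext_post[OF p] PA[OF j(1)] j(2) unfolding ext_def by auto
  next
    case False
    then show ?thesis using ext_post[OF p] by (simp add: ext_def pre0 PA0)
  qed
  have ext_distinct: "distinct (ext p)" if p: "p \<in> S" for p
  proof -
    have "distinct (pre p) \<and> set (pre p) \<inter> set p = {}"
    proof (cases "p \<in> snd ` J")
      case True
      then obtain j where j: "j \<in> J" "p = snd j" by blast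
      then show ?thesis
        using g(5)[OF j(1)] pre[OF j(1)] absorber_set_eq(5)[OF W gW[OF j(1)]] by (simp add: distinct_butlast)
    qed (simp add: pre0)
    moreover have "distinct (post p) \<and> set (post p) \<inter> set p = {}"
    proof (cases "p \<in> fst ` J")
      case True
      then obtain j where j: "j \<in> J" "p = fst j" by blast
      then show ?thesis
        using g(4)[OF j(1)] post[OF j(1)] absorber_set_eq(6)[OF W gW[OF j(1)]] by (simp add: distinct_tl)
    qed (simp add: post0)
    moreover have "set (pre p) \<inter> set (post p) = {}"
    proof (cases "p \<in> snd ` J \<and> p \<in> fst ` J")
      case True
      then obtain i j where ij: "i \<in> J" "j \<in> J" "p = snd i" "p = fst j" by blast
      then show ?thesis using g(6)[OF ij(1,2)] pre[OF ij(1)] post[OF ij(2)] by simp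
    qed (auto simp: pre0 post0)
    ultimately show ?thesis using SD(2)[OF p] unfolding ext_def by auto
  qed
  define Wu where "Wu = W - g ` J"
  have Wu: "absorber_family V E s l Wu"
    using absorber_family_subset[OF W] unfolding Wu_def by blast
  define Zu where "Zu = (\<Union>w\<in>Wu. absorber_arcs w)"
  have Zeq: "Z = Zu \<union> (\<Union>j\<in>J. hA j \<union> tA j)"
    unfolding Z_def Zu_def Wu_def absA[symmetric] using g(2) by blast
  have Zdisj: "Zu \<inter> (\<Union>j\<in>J. hA j \<union> tA j) = {}"
  proof (rule ccontr)
    assume "Zu \<inter> (\<Union>j\<in>J. hA j \<union> tA j) \<noteq> {}"
    then obtain e w j where "w \<in> Wu" "e \<in> absorber_arcs w" "j \<in> J" "e \<in> absorber_arcs (g j)"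
      unfolding Zu_def absA[symmetric] by blast
    then show False using WD(12)[of w "g j" e] g(2) unfolding Wu_def by blast
  qed
  have extS: "path_partition ((E - Z) \<union> (\<Union>j\<in>J. hA j \<union> tA j)) (ext ` S)"
    unfolding path_partition_def
  proof (intro conjI ballI)
    show "finite (ext ` S)" using SD(1) by simp
    fix q assume "q \<in> ext ` S"
    then obtain p where p: "p \<in> S" "q = ext p" by blast
    show "distinct q" using ext_distinct p by simp
    show "2 \<le> length q" using SD(3)[OF p(1)] p(2) by (simp add: ext_def)
  next
    have "(\<Union>q\<in>ext ` S. path_arcs q) = (\<Union>p\<in>S. PA p \<union> path_arcs p \<union> QA p)" using ext_arcs by simp
    also have "\<dots> = (\<Union>p\<in>S. path_arcs p) \<union> ((\<Union>p\<in>S. PA p) \<union> (\<Union>p\<in>S. QA p))" by blast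
    also have "(\<Union>p\<in>S. PA p) = (\<Union>j\<in>J. hA j)" using JD(2) unfolding PA_def by blast
    also have "(\<Union>p\<in>S. QA p) = (\<Union>j\<in>J. tA j)" using JD(1) unfolding QA_def by blast
    also have "(\<Union>p\<in>S. path_arcs p) = E - Z" using SD(6) by (simp add: Z_def)
    finally show "(\<Union>q\<in>ext ` S. path_arcs q) = (E - Z) \<union> (\<Union>j\<in>J. hA j \<union> tA j)" by blast
  next
    show "disjoint_family_on path_arcs (ext ` S)"
      unfolding disjoint_family_on_def
    proof (intro ballI impI)
      fix q q' assume "q \<in> ext ` S" "q' \<in> ext ` S" "q \<noteq> q'"
      then obtain p p' where p: "p \<in> S" "p' \<in> S" "q = ext p" "q' = ext p'" "p \<noteq> p'" by blast
      have sub: "path_arcs p \<inter> Z = {}" "path_arcs p' \<inter> Z = {}"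
        using SD(5)[OF p(1)] SD(5)[OF p(2)] by (auto simp: Z_def)
      have PQ: "PA t \<subseteq> Z" "QA t \<subseteq> Z" for t using AZ unfolding PA_def QA_def by blast+
      have d1: "path_arcs p \<inter> path_arcs p' = {}" using SD(8)[OF p(1,2)] p(5) by blast
      have d2: "PA p \<inter> PA p' = {}" using same p(5) unfolding PA_def by blast
      have d3: "QA p \<inter> QA p' = {}" using same p(5) unfolding QA_def by blast
      have d4: "PA t \<inter> QA t' = {}" for t t'
      proof (rule ccontr)
        assume "PA t \<inter> QA t' \<noteq> {}"
        then obtain e i j where e: "e \<in> hA i" "e \<in> tA j" "i \<in> J" "j \<in> J" unfolding PA_def QA_def by blast
        then have "i = j" using same by blast
        then show False using hAtA e by blast
      qed
      show "path_arcs q \<inter> path_arcs q' = {}"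
        unfolding p(3,4) ext_arcs[OF p(1)] ext_arcs[OF p(2)]
        using sub PQ d1 d2 d3 d4[of p p'] d4[of p' p] by blast
    qed
  qed
  let ?U = "(\<lambda>w. fst w @ tl (snd w)) ` Wu"
  have "((E - Z) \<union> (\<Union>j\<in>J. hA j \<union> tA j)) \<inter> Zu = {}" using Zdisj Zeq by blast
  from path_partition_Un[OF extS absorber_path_partition[OF Wu s, folded Zu_def] this]
  have "path_partition (((E - Z) \<union> (\<Union>j\<in>J. hA j \<union> tA j)) \<union> Zu) (ext ` S \<union> ?U)" .
  moreover have "((E - Z) \<union> (\<Union>j\<in>J. hA j \<union> tA j)) \<union> Zu = E" using Zeq ZE by blast
  ultimately have part: "path_partition E (ext ` S \<union> ?U)" by simp
  have head: "int s \<le> arc_excess E (hd q) \<or> (\<exists>p\<in>S. p \<notin> snd ` J \<and> hd p = hd q)" if "q \<in> ext ` S \<union> ?U" for q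
  proof -
    from that consider p where "p \<in> S" "q = ext p" | w where "w \<in> W" "q = fst w @ tl (snd w)"
      unfolding Wu_def by blast
    then show ?thesis
    proof cases
      case 1
      show ?thesis
      proof (cases "p \<in> snd ` J")
        case True
        then obtain j where j: "j \<in> J" "p = snd j" by blast
        let ?h = "fst (g j)"
        have "?h = butlast ?h @ [hd p]"
          using WD(2,4)[OF gW[OF j(1)]] g(3)[OF j(1)] JD(3)[OF j(1)] j(2) by (metis append_butlast_last_id)
        moreover have "hd (butlast ?h @ [hd p]) = hd (ext p)"
          using pre[OF j(1)] j(2) SD(4)[OF 1(1)] by (cases "butlast ?h") (simp_all add: ext_def)
        ultimately have "hd (ext p) = hd ?h" by metis
        then show ?thesis using WD(10)[OF gW[OF j(1)]] 1 by simp
      next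
        case False
        then show ?thesis using 1 SD(4)[OF 1(1)] by (auto simp: ext_def pre0)
      qed
    next
      case 2
      then have "(fst w, snd w) \<in> W" by simp
      from WD(2,10)[OF this] show ?thesis using 2 by simp
    qed
  qed
  have tail: "arc_excess E (last q) \<le> - int s \<or> (\<exists>p\<in>S. p \<notin> fst ` J \<and> last p = last q)" if "q \<in> ext ` S \<union> ?U" for q
  proof -
    from that consider p where "p \<in> S" "q = ext p" | w where "w \<in> W" "q = fst w @ tl (snd w)"
      unfolding Wu_def by blast
    then show ?thesis
    proof cases
      case 1
      show ?thesis
      proof (cases "p \<in> fst ` J")
        case True
        then obtain j where j: "j \<in> J" "p = fst j" by blast
        let ?t = "snd (g j)"
        have t: "?t = last p # tl ?t"
          using WD(3)[OF gW[OF j(1)]] g(3)[OF j(1)] j(2) by (metis list.collapse)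
        have "last (ext p) = last (last p # tl ?t)"
          using post[OF j(1)] j(2) SD(4)[OF 1(1)] by (simp add: ext_def)
        then have "last (ext p) = last ?t" using t by metis
        then show ?thesis using WD(11)[OF gW[OF j(1)]] 1 by simp
      next
        case False
        then show ?thesis using 1 SD(4)[OF 1(1)] by (auto simp: ext_def post0)
      qed
    next
      case 2
      then have m: "(fst w, snd w) \<in> W" by simp
      have "last (fst w @ tl (snd w)) = last (snd w)"
        using WD(2-4)[OF m] by (cases "snd w") auto
      then show ?thesis using WD(11)[OF m] 2 by simp
    qed
  qed
  let ?P = "(\<lambda>w. fst w @ tl (snd w)) ` W"
  \<comment> \<open>The excess is read off before any cutting, from \<open>S\<close> and all
    absorbers as whole paths; the latter contribute at most \<open>s\<close> in absolute
    value.\<close>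
  have excess: "arc_excess E v = int (starts S v) - int (ends S v) + (int (starts ?P v) - int (ends ?P v))" for v
  proof -
    have "E = (E - Z) \<union> Z" using ZE by blast
    then have "arc_excess E v = arc_excess (E - Z) v + arc_excess Z v"
      using finE ZE arc_excess_Un[of "E - Z" Z v] by (metis Diff_disjoint finite_Diff finite_subset inf_commute)
    then show ?thesis
      using arc_excess_partition[OF S, of v] arc_excess_partition[OF absorber_path_partition[OF W s], of v]
      by (simp add: Z_def)
  qed
  have starts_P: "starts ?P v \<le> s" for v
  proof -
    have "{p \<in> ?P. hd p = v} \<subseteq> (\<lambda>w. fst w @ tl (snd w)) ` {w \<in> W. hd (fst w) = v}"
    proof
      fix p assume "p \<in> {p \<in> ?P. hd p = v}"
      then obtain w where w: "w \<in> W" "p = fst w @ tl (snd w)" "hd p = v" by blast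
      then have "(fst w, snd w) \<in> W" by simp
      from WD(2)[OF this] show "p \<in> (\<lambda>w. fst w @ tl (snd w)) ` {w \<in> W. hd (fst w) = v}" using w by auto
    qed
    then have "starts ?P v \<le> card ((\<lambda>w. fst w @ tl (snd w)) ` {w \<in> W. hd (fst w) = v})"
      unfolding starts_def using WD(1) by (intro card_mono) simp_all
    also have "\<dots> \<le> card {w \<in> W. hd (fst w) = v}" using WD(1) by (intro card_image_le) simp
    finally have "starts ?P v \<le> card {w \<in> W. hd (fst w) = v}" .
    then show ?thesis using first[of v] by linarith
  qed
  have ends_P: "ends ?P v \<le> s" for v
  proof -
    have "{p \<in> ?P. last p = v} \<subseteq> (\<lambda>w. fst w @ tl (snd w)) ` {w \<in> W. last (snd w) = v}"
    proof
      fix p assume "p \<in> {p \<in> ?P. last p = v}"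
      then obtain w where w: "w \<in> W" "p = fst w @ tl (snd w)" "last p = v" by blast
      then have m: "(fst w, snd w) \<in> W" by simp
      have "last (fst w @ tl (snd w)) = last (snd w)"
        using WD(2-4)[OF m] by (cases "snd w") auto
      then show "p \<in> (\<lambda>w. fst w @ tl (snd w)) ` {w \<in> W. last (snd w) = v}" using w by auto
    qed
    then have "ends ?P v \<le> card ((\<lambda>w. fst w @ tl (snd w)) ` {w \<in> W. last (snd w) = v})"
      unfolding ends_def using WD(1) by (intro card_mono) simp_all
    also have "\<dots> \<le> card {w \<in> W. last (snd w) = v}" using WD(1) by (intro card_image_le) simp
    finally have "ends ?P v \<le> card {w \<in> W. last (snd w) = v}" .
    then show ?thesis using last[of v] by linarith
  qed
  have imgM: "fst ` M v \<subseteq> fst ` J" "snd ` M v \<subseteq> snd ` J" for v unfolding J_def by blast+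
  have cardM: "card (fst ` M v) = card (M v)" "card (snd ` M v) = card (M v)" for v
    using M(2,3) by (simp_all add: card_image)
  \<comment> \<open>An end left over at \<open>v\<close> shows that the pairing used up all starts
    at \<open>v\<close>, so the ends are in strict majority.\<close>
  have unpaired_end: "starts S v < ends S v" if p: "p \<in> S" "p \<notin> fst ` J" "last p = v" for p v
  proof -
    have "p \<notin> fst ` M v" using p(2) imgM by blast
    then have "snd ` M v = {p \<in> S. hd p = v}" and "fst ` M v \<noteq> {p \<in> S. last p = v}" using p M(5)[of v] by auto
    moreover have "fst ` M v \<subseteq> {p \<in> S. last p = v}" using M(1)[of v] by auto
    ultimately have "card (fst ` M v) < card {p \<in> S. last p = v}"
      using SD(1) by (intro psubset_card_mono) auto
    then show ?thesis using \<open>snd ` M v = _\<close> cardM[of v] unfolding starts_def ends_def by simp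
  qed
  have unpaired_start: "ends S v < starts S v" if p: "p \<in> S" "p \<notin> snd ` J" "hd p = v" for p v
  proof -
    have "p \<notin> snd ` M v" using p(2) imgM by blast
    then have "fst ` M v = {p \<in> S. last p = v}" and "snd ` M v \<noteq> {p \<in> S. hd p = v}" using p M(5)[of v] by auto
    moreover have "snd ` M v \<subseteq> {p \<in> S. hd p = v}" using M(1)[of v] by auto
    ultimately have "card (snd ` M v) < card {p \<in> S. hd p = v}"
      using SD(1) by (intro psubset_card_mono) auto
    then show ?thesis using \<open>fst ` M v = _\<close> cardM[of v] unfolding starts_def ends_def by simp
  qed
  have "starts (ext ` S \<union> ?U) v = 0 \<or> ends (ext ` S \<union> ?U) v = 0" for v
  proof (rule ccontr)
    assume "\<not> ?thesis"
    then have "{q \<in> ext ` S \<union> ?U. hd q = v} \<noteq> {}" "{q \<in> ext ` S \<union> ?U. last q = v} \<noteq> {}"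
      unfolding starts_def ends_def by (metis card.empty)+
    then obtain q q' where q: "q \<in> ext ` S \<union> ?U" "hd q = v" "q' \<in> ext ` S \<union> ?U" "last q' = v" by blast
    have 1: "int s \<le> arc_excess E v \<or> (\<exists>p\<in>S. p \<notin> snd ` J \<and> hd p = v)" using head[OF q(1)] q(2) by simp
    have 2: "arc_excess E v \<le> - int s \<or> (\<exists>p\<in>S. p \<notin> fst ` J \<and> last p = v)" using tail[OF q(3)] q(4) by simp
    have 3: "ends S v < starts S v \<or> int s \<le> arc_excess E v" using 1 unpaired_start by blast
    have 4: "starts S v < ends S v \<or> arc_excess E v \<le> - int s" using 2 unpaired_end by blast
    show False using 3 4 excess[of v] starts_P[of v] ends_P[of v] s by linarith
  qed
  then show ?thesis using part by blast
qed

section \<open>Tournaments of large excess\<close>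

text \<open>The bound on \<open>N\<close> allows for the \<open>4 * q\<close> joins at one centre,
  the \<open>2 * (L + 3)\<close> vertices of the two paths to be joined and the \<open>2 * l\<close>
  vertices of halves already attached to them. The bound on \<open>s\<close> also ensures that the
  at most \<open>N + U\<close> absorbers touching a vertex number fewer than
  \<open>s\<close>.\<close>

lemma tournament_path_partition:
  assumes V: "finite V" "E \<subseteq> V \<times> V" and loopfree: "\<And>u v. (u, v) \<in> E \<Longrightarrow> u \<noteq> v"
    and tour: "\<And>u v. u \<in> V \<Longrightarrow> v \<in> V \<Longrightarrow> u \<noteq> v \<Longrightarrow> (u, v) \<in> E \<longleftrightarrow> (v, u) \<notin> E"
    and high: "3 * s \<le> card {v \<in> V. int s \<le> arc_excess E v}"
    and low: "3 * s \<le> card {v \<in> V. arc_excess E v \<le> - int s}"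
    and l: "card V \<le> 2 ^ l"
    and U: "1 \<le> U" "2 * l * (card V * N) \<le> U * U" "2 * U + N + 2 * l * N + l < s"
    and L: "1 \<le> L" "1 \<le> q" "2 * (card V * card V) \<le> L * (q * q)" "2 * ((L + 2) * card V) \<le> q * q"
    and N: "4 * q + 2 * (L + 3) + 2 * l \<le> N"
  shows "\<exists>Q. path_partition E Q \<and> (\<forall>v. starts Q v = 0 \<or> ends Q v = 0)"
proof -
  from absorber_family_exists[OF V tour U l high low] obtain W where W: "absorber_family V E s l W"
    "\<And>x. x \<in> V \<Longrightarrow> card {w \<in> W. hd (snd w) = x} = N"
    "\<And>v. card {w \<in> W. v \<in> body w} \<le> U"
    "\<And>w. w \<in> W \<Longrightarrow> hd (snd w) \<in> V" by blast
  note WD = absorber_familyD[OF W(1)]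
  have asym: "(v, u) \<notin> E" if "(u, v) \<in> E" for u v
    using that loopfree tour V(2) by blast
  have centre_le: "card {w \<in> W. hd (snd w) = v} \<le> N" for v
  proof (cases "v \<in> V")
    case False
    then have "{w \<in> W. hd (snd w) = v} = {}" using W(4) by blast
    then have "card {w \<in> W. hd (snd w) = v} = 0" by (simp only: card.empty)
    then show ?thesis by (simp only: le0)
  qed (simp add: W(2))
  have touch: "card {w \<in> W. f w = v} \<le> s"
    if f: "\<And>w. w \<in> W \<Longrightarrow> f w = hd (snd w) \<or> f w \<in> body w" for f v
  proof -
    have "{w \<in> W. f w = v} \<subseteq> {w \<in> W. hd (snd w) = v} \<union> {w \<in> W. v \<in> body w}"
    proof
      fix w assume "w \<in> {w \<in> W. f w = v}"
      then have "w \<in> W" "f w = v" by simp_all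
      then show "w \<in> {w \<in> W. hd (snd w) = v} \<union> {w \<in> W. v \<in> body w}" using f[of w] by force
    qed
    then have "card {w \<in> W. f w = v} \<le> card ({w \<in> W. hd (snd w) = v} \<union> {w \<in> W. v \<in> body w})"
      using WD(1) by (intro card_mono) simp_all
    also have "\<dots> \<le> card {w \<in> W. hd (snd w) = v} + card {w \<in> W. v \<in> body w}" by (rule card_Un_le)
    also have "\<dots> \<le> s" using centre_le[of v] W(3)[of v] U(3) by linarith
    finally show ?thesis .
  qed
  have first: "card {w \<in> W. hd (fst w) = v} \<le> s" for v
  proof (rule touch)
    fix w assume "w \<in> W"
    then have m: "(fst w, snd w) \<in> W" by simp
    have "hd (fst w) \<in> set (fst w)" using WD(2)[OF m] by simp
    then show "hd (fst w) = hd (snd w) \<or> hd (fst w) \<in> body w"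
      unfolding absorber_set_eq(1)[OF W(1) m] body_def by blast
  qed
  have last: "card {w \<in> W. last (snd w) = v} \<le> s" for v
  proof (rule touch)
    fix w assume "w \<in> W"
    then have m: "(fst w, snd w) \<in> W" by simp
    have "last (snd w) \<in> set (snd w)" using WD(3)[OF m] by simp
    then show "last (snd w) = hd (snd w) \<or> last (snd w) \<in> body w"
      unfolding absorber_set_eq(2)[OF W(1) m] body_def by blast
  qed
  let ?D = "E - (\<Union>w\<in>W. absorber_arcs w)"
  have D: "?D \<subseteq> V \<times> V" "\<And>u v. (u, v) \<in> ?D \<Longrightarrow> (v, u) \<notin> ?D" using V(2) asym by blast+
  obtain S where S: "path_partition ?D S" "\<And>p. p \<in> S \<Longrightarrow> length p \<le> L + 3"
    "\<And>v. min (starts S v) (ends S v) \<le> 4 * q"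
    using short_path_partition[OF V(1) D L] by blast
  have "0 < s" using U(3) by simp
  from absorb[OF W(1) this V W(2) first last S N] show ?thesis by blast
qed

section \<open>Many vertices of large excess\<close>

lemma arc_excess_degrees:
  assumes "finite E"
  shows "arc_excess E v = int (card {e \<in> E. fst e = v}) - int (card {e \<in> E. snd e = v})"
  using assms by (simp add: arc_excess_def sum_subtractf of_bool_def sum.If_cases Int_def)

lemma arc_excess_le:
  assumes "finite V" "E \<subseteq> V \<times> V"
  shows "\<bar>arc_excess E v\<bar> \<le> int (card V)"
proof -
  have fin: "finite E" using assms by (meson finite_SigmaI finite_subset)
  have "{e \<in> E. fst e = v} \<subseteq> Pair v ` V" "{e \<in> E. snd e = v} \<subseteq> (\<lambda>u. (u, v)) ` V" using assms(2) by auto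
  then have "card {e \<in> E. fst e = v} \<le> card V" "card {e \<in> E. snd e = v} \<le> card V"
    using assms(1) by (meson card_image_le card_mono finite_imageI order_trans)+
  then show ?thesis unfolding arc_excess_degrees[OF fin] by linarith
qed

lemma sum_arc_excess:
  assumes "finite V" "E \<subseteq> V \<times> V"
  shows "(\<Sum>v\<in>V. arc_excess E v) = 0"
proof -
  have "(\<Sum>v\<in>V. arc_excess E v) = (\<Sum>e\<in>E. \<Sum>v\<in>V. of_bool (fst e = v) - of_bool (snd e = v))"
    unfolding arc_excess_def by (rule sum.swap)
  also have "\<dots> = (\<Sum>e\<in>E. 0)"
    using assms by (intro sum.cong) (auto simp: sum_subtractf of_bool_def)
  finally show ?thesis by simp
qed

text \<open>Vertices with \<open>int s <= f v\<close> contribute at most \<open>card V\<close> each,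
  and all others together at most \<open>s * card V\<close>. Removing this share from the factor 4
  leaves 3.\<close>

lemma many_large_values:
  fixes f :: "'a \<Rightarrow> int"
  assumes "finite V" "V \<noteq> {}" "\<And>v. v \<in> V \<Longrightarrow> f v \<le> int (card V)"
    and "4 * int s * int (card V) \<le> (\<Sum>v\<in>V. max (f v) 0)"
  shows "3 * s \<le> card {v \<in> V. int s \<le> f v}"
proof -
  let ?A = "{v \<in> V. int s \<le> f v}" and ?n = "int (card V)"
  have "(\<Sum>v\<in>V. max (f v) 0) \<le> (\<Sum>v\<in>V. (if v \<in> ?A then ?n else 0) + int s)"
    by (rule sum_mono) (use assms(3) in \<open>force\<close>)
  also have "\<dots> = int (card ?A) * ?n + ?n * int s"
    using assms(1) by (simp add: sum.distrib sum.If_cases Int_def)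
  finally have "4 * int s * ?n \<le> int (card ?A) * ?n + ?n * int s" using assms(4) by linarith
  then have "?n * (3 * int s) \<le> ?n * int (card ?A)" by (simp add: algebra_simps)
  moreover have "0 < ?n" using assms(1,2) by (simp add: card_gt_0_iff)
  ultimately have "3 * int s \<le> int (card ?A)" by (simp only: mult_le_cancel_left_pos)
  then show ?thesis by linarith
qed

section \<open>From vertex lists to arc walks\<close>

lemma awalk_verts_zip:
  "p \<noteq> [] \<Longrightarrow> pre_digraph.awalk_verts (with_proj D) (hd p) (zip p (tl p)) = p"
  by (induction p rule: induct_list012) (simp_all add: pre_digraph.awalk_verts.simps)

lemma cas_zip: "p \<noteq> [] \<Longrightarrow> pre_digraph.cas (with_proj D) (hd p) (zip p (tl p)) (last p)"
  by (induction p rule: induct_list012) (simp_all add: pre_digraph.cas.simps)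

lemma apath_zip:
  assumes "distinct p" "p \<noteq> []" "hd p \<in> pverts D" "path_arcs p \<subseteq> parcs D"
  shows "pre_digraph.apath (with_proj D) (hd p) (zip p (tl p)) (last p)"
  unfolding pre_digraph.apath_def pre_digraph.awalk_def
  using assms by (simp add: awalk_verts_zip cas_zip path_arcs_def)

text \<open>The first arc gives the first vertex, and \<open>awalk_verts\<close> rebuilds the list
  from it. One-vertex lists must be excluded, as they all have the empty arc list.\<close>

lemma zip_tl_inj:
  assumes "zip p (tl p) = zip q (tl q)" "2 \<le> length p" "2 \<le> length q"
  shows "p = q"
proof -
  have "hd (zip r (tl r)) = (hd r, hd (tl r))" if "2 \<le> length r" for r :: "'a list"
    using that by (cases r; cases "tl r") auto
  then have "hd p = hd q" using assms by (metis fst_conv)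
  then show ?thesis using assms awalk_verts_zip[of p] awalk_verts_zip[of q]
    by (metis list.size(3) not_numeral_le_zero)
qed

lemma excess_eq_arc_excess:
  "finite (parcs D) \<Longrightarrow> excess D v = arc_excess (parcs D) v"
  unfolding excess_def out_degree_def in_degree_def out_arcs_def in_arcs_def
  by (simp add: arc_excess_degrees)

text \<open>Where starts and ends do not meet, \<open>starts Q v\<close> equals
  \<open>pos_excess D v\<close>; summing over \<open>v\<close> counts every path once, at its
  start.\<close>

lemma perfect_decomposition_of_path_partition:
  assumes fin: "finite (pverts D)" and sub: "parcs D \<subseteq> pverts D \<times> pverts D"
    and Q: "path_partition (parcs D) Q" and no_both: "\<And>v. starts Q v = 0 \<or> ends Q v = 0"
  shows "perfect_decomposition D ((\<lambda>p. zip p (tl p)) ` Q)"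
proof -
  note QD = path_partitionD[OF Q]
  have finE: "finite (parcs D)" using fin sub by (meson finite_SigmaI finite_subset)
  have hdV: "hd p \<in> pverts D" if p: "p \<in> Q" for p
  proof -
    obtain a b q where "p = a # b # q" using QD(3)[OF p] by (metis Suc_le_length_iff numeral_2_eq_2)
    then show ?thesis using QD(5)[OF p] sub by auto
  qed
  have inj: "inj_on (\<lambda>p. zip p (tl p)) Q"
    by (rule inj_onI) (use zip_tl_inj QD(3) in blast)
  have "pos_excess D v = int (starts Q v)" for v
    unfolding pos_excess_def excess_eq_arc_excess[OF finE] arc_excess_partition[OF Q]
    using no_both[of v] by auto
  then have "total_excess D = (\<Sum>v\<in>pverts D. int (starts Q v))" by (simp add: total_excess_def)
  also have "\<dots> = int (card Q)"
    using sum_starts[OF fin QD(1) hdV] by (metis of_nat_sum)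
  finally have total: "total_excess D = int (card Q)" .
  show ?thesis
    unfolding perfect_decomposition_def
  proof (intro conjI ballI)
    show "finite ((\<lambda>p. zip p (tl p)) ` Q)" using QD(1) by simp
    show "int (card ((\<lambda>p. zip p (tl p)) ` Q)) = total_excess D"
      using total card_image[OF inj] by simp
    show "disjoint_family_on set ((\<lambda>p. zip p (tl p)) ` Q)"
      unfolding disjoint_family_on_def
    proof (intro ballI impI)
      fix a b assume "a \<in> (\<lambda>p. zip p (tl p)) ` Q" "b \<in> (\<lambda>p. zip p (tl p)) ` Q" "a \<noteq> b"
      then obtain p r where "p \<in> Q" "r \<in> Q" "a = zip p (tl p)" "b = zip r (tl r)" "p \<noteq> r" by blast
      then show "set a \<inter> set b = {}" using QD(8)[of p r] unfolding path_arcs_def by blast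
    qed
    show "(\<Union>p\<in>(\<lambda>p. zip p (tl p)) ` Q. set p) = parcs D"
      using QD(6) by (simp add: path_arcs_def)
    fix a assume "a \<in> (\<lambda>p. zip p (tl p)) ` Q"
    then obtain p where p: "p \<in> Q" "a = zip p (tl p)" by blast
    show "a \<noteq> []" using QD(3)[OF p(1)] p(2) by (cases p; cases "tl p") auto
    show "\<exists>u v. pre_digraph.apath (with_proj D) u a v"
      using apath_zip[OF QD(2,4)[OF p(1)] hdV[OF p(1)] QD(5)[OF p(1)]] p(2) by blast
  qed
qed

section \<open>Choice of the parameters\<close>

text \<open>With \<open>q = n^0.755\<close> both \<open>L * q^2\<close> over \<open>n^2\<close> and
  \<open>q^2\<close> over \<open>L * n\<close> are \<open>n^0.01\<close>; \<open>N = n^0.76\<close>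
  exceeds \<open>q\<close> by a factor \<open>n^0.005\<close>; and \<open>n * N = n^1.76\<close>
  stays below \<open>U^2\<close> of order \<open>n^(16/9)\<close>, with room for the logarithm
  \<open>l\<close>. The divisor 8 makes \<open>2 * U\<close> a quarter of \<open>s\<close>.\<close>

lemma eventually_parameters:
  shows "\<forall>\<^sub>F n :: nat in sequentially. \<exists>s U N q L l :: nat.
    real s \<le> real n powr (8/9) \<and> 0 < s \<and> n \<le> 2 ^ l \<and> 1 \<le> U \<and> 2 * l * (n * N) \<le> U * U \<and>
    2 * U + N + 2 * l * N + l < s \<and> 1 \<le> L \<and> 1 \<le> q \<and> 2 * (n * n) \<le> L * (q * q) \<and>
    2 * ((L + 2) * n) \<le> q * q \<and> 4 * q + 2 * (L + 3) + 2 * l \<le> N"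
proof -
  define s' where "s' n = real n powr (8/9)" for n
  define U' where "U' n = real n powr (8/9) / 8" for n
  define N' where "N' n = real n powr (19/25)" for n
  define q' where "q' n = real n powr (151/200)" for n
  define L' where "L' n = real n powr (1/2)" for n
  define l' where "l' n = log 2 (real n) + 1" for n
  note defs = s'_def U'_def N'_def q'_def L'_def l'_def
  \<comment> \<open>The inequalities are proved for real parameters; each \<open>- 1\<close> pays
    for rounding down, and \<open>l' n\<close> already includes the rounding up.\<close>
  have "\<forall>\<^sub>F n in sequentially. 2 * l' n * (n * N' n) \<le> (U' n - 1) * (U' n - 1)"
    unfolding defs by real_asymp
  moreover have "\<forall>\<^sub>F n in sequentially. 2 * U' n + N' n + 2 * l' n * N' n + l' n < s' n - 1"
    unfolding defs by real_asymp
  moreover have "\<forall>\<^sub>F n in sequentially. 2 * (real n * real n) \<le> (L' n - 1) * ((q' n - 1) * (q' n - 1))"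
    unfolding defs by real_asymp
  moreover have "\<forall>\<^sub>F n in sequentially. 2 * ((L' n + 2) * real n) \<le> (q' n - 1) * (q' n - 1)"
    unfolding defs by real_asymp
  moreover have "\<forall>\<^sub>F n in sequentially. 4 * q' n + 2 * (L' n + 3) + 2 * l' n \<le> N' n - 1"
    unfolding defs by real_asymp
  moreover have "\<forall>\<^sub>F n in sequentially. 2 \<le> s' n"
    unfolding defs by real_asymp
  moreover have "\<forall>\<^sub>F n in sequentially. 2 \<le> U' n"
    unfolding defs by real_asymp
  moreover have "\<forall>\<^sub>F n in sequentially. 2 \<le> q' n"
    unfolding defs by real_asymp
  moreover have "\<forall>\<^sub>F n in sequentially. 2 \<le> L' n"
    unfolding defs by real_asymp
  moreover have "\<forall>\<^sub>F n :: nat in sequentially. 1 \<le> n" by (rule eventually_ge_at_top)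
  ultimately show ?thesis
  proof eventually_elim
    case (elim n)
    define s U N q L l where "s = nat \<lfloor>s' n\<rfloor>" and "U = nat \<lfloor>U' n\<rfloor>" and "N = nat \<lfloor>N' n\<rfloor>"
      and "q = nat \<lfloor>q' n\<rfloor>" and "L = nat \<lfloor>L' n\<rfloor>" and "l = nat \<lceil>log 2 (real n)\<rceil>"
    have floor: "real (nat \<lfloor>x\<rfloor>) \<le> x" "x - 1 \<le> real (nat \<lfloor>x\<rfloor>)" if "0 \<le> x" for x :: real
      using that by linarith+
    have N0: "0 \<le> N' n" by (simp add: N'_def)
    have s: "real s \<le> s' n" "s' n - 1 \<le> real s" unfolding s_def using floor[of "s' n"] elim by auto
    have U: "real U \<le> U' n" "U' n - 1 \<le> real U" unfolding U_def using floor[of "U' n"] elim by auto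
    have N: "real N \<le> N' n" "N' n - 1 \<le> real N" unfolding N_def using floor[OF N0] by auto
    have q: "real q \<le> q' n" "q' n - 1 \<le> real q" unfolding q_def using floor[of "q' n"] elim by auto
    have L: "real L \<le> L' n" "L' n - 1 \<le> real L" unfolding L_def using floor[of "L' n"] elim by auto
    have log0: "0 \<le> log 2 (real n)" using elim by simp
    have l: "real l \<le> l' n" "log 2 (real n) \<le> real l" unfolding l_def l'_def using log0 by linarith+
    have "real n = 2 powr log 2 (real n)" using elim by simp
    also have "\<dots> \<le> 2 powr real l" using l by simp
    also have "\<dots> = real (2 ^ l)" by (simp add: powr_realpow)
    finally have "real n \<le> real (2 ^ l)" .
    then have nl: "n \<le> 2 ^ l" by (simp only: of_nat_le_iff)
    have "real (2 * l * (n * N)) = 2 * real l * (real n * real N)" by simp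
    also have "\<dots> \<le> 2 * l' n * (real n * N' n)" using l N by (intro mult_mono) auto
    also have "\<dots> \<le> (U' n - 1) * (U' n - 1)" using elim by simp
    also have "\<dots> \<le> real U * real U" using U elim by (intro mult_mono) auto
    finally have "real (2 * l * (n * N)) \<le> real (U * U)" by simp
    then have 1: "2 * l * (n * N) \<le> U * U" by (simp only: of_nat_le_iff)
    have "2 * real l * real N \<le> 2 * l' n * N' n" using l N by (intro mult_mono) auto
    then have "real (2 * U + N + 2 * l * N + l) \<le> 2 * U' n + N' n + 2 * l' n * N' n + l' n"
      using l(1) N(1) U(1) by simp
    also have "\<dots> < real s" using elim s by linarith
    finally have 2: "2 * U + N + 2 * l * N + l < s" by (simp only: of_nat_less_iff)
    have "real (2 * (n * n)) = 2 * (real n * real n)" by simp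
    also have "\<dots> \<le> (L' n - 1) * ((q' n - 1) * (q' n - 1))" using elim by simp
    also have "\<dots> \<le> real L * (real q * real q)" using L q elim by (intro mult_mono) auto
    finally have "real (2 * (n * n)) \<le> real (L * (q * q))" by simp
    then have 3: "2 * (n * n) \<le> L * (q * q)" by (simp only: of_nat_le_iff)
    have "real (2 * ((L + 2) * n)) = 2 * ((real L + 2) * real n)" by (simp add: algebra_simps)
    also have "\<dots> \<le> 2 * ((L' n + 2) * real n)" using L by (intro mult_mono) auto
    also have "\<dots> \<le> (q' n - 1) * (q' n - 1)" using elim by simp
    also have "\<dots> \<le> real q * real q" using q elim by (intro mult_mono) auto
    finally have "real (2 * ((L + 2) * n)) \<le> real (q * q)" by simp
    then have 4: "2 * ((L + 2) * n) \<le> q * q" by (simp only: of_nat_le_iff)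
    have "real (4 * q + 2 * (L + 3) + 2 * l) \<le> 4 * q' n + 2 * (L' n + 3) + 2 * l' n"
      using q(1) L(1) l(1) by simp
    also have "\<dots> \<le> real N" using elim N by linarith
    finally have 5: "4 * q + 2 * (L + 3) + 2 * l \<le> N" by (simp only: of_nat_le_iff)
    have 6: "0 < s" "1 \<le> U" "1 \<le> L" "1 \<le> q" using s(2) U(2) L(2) q(2) elim by linarith+
    show ?case using s(1) nl 1 2 3 4 5 6 unfolding s'_def by blast
  qed
qed

theorem theorem3p5:
  fixes \<gamma> :: real
  assumes "\<gamma> > 0"
  shows "\<exists>n0::nat. \<forall>n\<ge>n0. \<forall>T :: 'a pair_pre_digraph.
           tournament T \<longrightarrow> card (pverts T) = n \<longrightarrow>
           real_of_int (total_excess T) \<ge> 8 * real n powr (17/9 + \<gamma>) \<longrightarrow>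
           (\<exists>P. perfect_decomposition T P)"
proof -
  obtain n0 where n0: "\<And>n. n0 \<le> n \<Longrightarrow> \<exists>s U N q L l :: nat.
    real s \<le> real n powr (8/9) \<and> 0 < s \<and> n \<le> 2 ^ l \<and> 1 \<le> U \<and> 2 * l * (n * N) \<le> U * U \<and>
    2 * U + N + 2 * l * N + l < s \<and> 1 \<le> L \<and> 1 \<le> q \<and> 2 * (n * n) \<le> L * (q * q) \<and>
    2 * ((L + 2) * n) \<le> q * q \<and> 4 * q + 2 * (L + 3) + 2 * l \<le> N"
    using eventually_parameters unfolding eventually_sequentially by blast
  have "\<exists>P. perfect_decomposition T P"
    if n: "max n0 1 \<le> card (pverts T)" and T: "tournament T"
      and ex: "8 * real (card (pverts T)) powr (17/9 + \<gamma>) \<le> real_of_int (total_excess T)"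
    for T :: "'a pair_pre_digraph"
  proof -
    interpret T: tournament T by (rule T)
    let ?V = "pverts T" and ?E = "parcs T"
    have V: "finite ?V" "?E \<subseteq> ?V \<times> ?V"
      using T.pair_finite_verts T.arc_fst_in_verts T.arc_snd_in_verts by (auto simp: subset_iff mem_Times_iff)
    have "?V \<noteq> {}" using n by auto
    obtain s U N q L l where par: "real s \<le> real (card ?V) powr (8/9)" "0 < s" "card ?V \<le> 2 ^ l" "1 \<le> U"
      "2 * l * (card ?V * N) \<le> U * U" "2 * U + N + 2 * l * N + l < s" "1 \<le> L" "1 \<le> q"
      "2 * (card ?V * card ?V) \<le> L * (q * q)" "2 * ((L + 2) * card ?V) \<le> q * q" "4 * q + 2 * (L + 3) + 2 * l \<le> N"
      using n0[of "card ?V"] n by auto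
    have total: "total_excess T = (\<Sum>v\<in>?V. max (arc_excess ?E v) 0)"
      unfolding total_excess_def pos_excess_def by (simp add: excess_eq_arc_excess)
    \<comment> \<open>The split \<open>17/9 = 8/9 + 1\<close>: one factor \<open>card ?V\<close>
      bounds the excess of a single vertex, the rest bounds \<open>s\<close>.\<close>
    have "4 * real s * real (card ?V) \<le> 4 * (real (card ?V) powr (8/9) * real (card ?V) powr 1)"
      using par(1) by (simp add: mult_right_mono)
    also have "\<dots> = 4 * real (card ?V) powr (17/9)"
      by (simp only: powr_add[symmetric]) simp
    also have "\<dots> \<le> 8 * real (card ?V) powr (17/9 + \<gamma>)"
    proof -
      have "real (card ?V) powr (17/9) \<le> real (card ?V) powr (17/9 + \<gamma>)"
        using n assms by (intro powr_mono) auto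
      moreover have "0 \<le> real (card ?V) powr (17/9)" by simp
      ultimately show ?thesis by linarith
    qed
    also have "\<dots> \<le> real_of_int (total_excess T)" by (rule ex)
    finally have "real_of_int (4 * int s * int (card ?V)) \<le> real_of_int (total_excess T)" by simp
    then have large: "4 * int s * int (card ?V) \<le> (\<Sum>v\<in>?V. max (arc_excess ?E v) 0)"
      unfolding total by (simp only: of_int_le_iff)
    \<comment> \<open>The excesses sum to zero, so the positive and the negative parts have equal
      totals, and the hypothesis supplies vertices of both kinds.\<close>
    have "arc_excess ?E v = max (arc_excess ?E v) 0 - max (- arc_excess ?E v) 0" for v by auto
    then have "(\<Sum>v\<in>?V. arc_excess ?E v) = (\<Sum>v\<in>?V. max (arc_excess ?E v) 0 - max (- arc_excess ?E v) 0)"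
      by (rule sum.cong[OF refl])
    then have "(\<Sum>v\<in>?V. max (- arc_excess ?E v) 0) = (\<Sum>v\<in>?V. max (arc_excess ?E v) 0)"
      using sum_arc_excess[OF V] by (simp add: sum_subtractf)
    then have large': "4 * int s * int (card ?V) \<le> (\<Sum>v\<in>?V. max (- arc_excess ?E v) 0)"
      using large by simp
    have abs: "arc_excess ?E v \<le> int (card ?V)" "- arc_excess ?E v \<le> int (card ?V)" for v
      using arc_excess_le[OF V, of v] by linarith+
    have high: "3 * s \<le> card {v \<in> ?V. int s \<le> arc_excess ?E v}"
      by (rule many_large_values[OF V(1) \<open>?V \<noteq> {}\<close> abs(1) large])
    have "3 * s \<le> card {v \<in> ?V. int s \<le> - arc_excess ?E v}"
      by (rule many_large_values[OF V(1) \<open>?V \<noteq> {}\<close> abs(2) large'])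
    then have low: "3 * s \<le> card {v \<in> ?V. arc_excess ?E v \<le> - int s}"
      by (simp only: le_minus_iff)
    have "\<exists>Q. path_partition ?E Q \<and> (\<forall>v. starts Q v = 0 \<or> ends Q v = 0)"
    proof (rule tournament_path_partition[OF V _ _ high low par(3-11)])
      show "u \<noteq> v" if "(u, v) \<in> ?E" for u v using T.pair_no_loops[OF that] by simp
      show "(u, v) \<in> ?E \<longleftrightarrow> (v, u) \<notin> ?E" if "u \<in> ?V" "v \<in> ?V" "u \<noteq> v" for u v
        by (rule T.exactly_one_orientation[OF that])
    qed
    then show ?thesis using perfect_decomposition_of_path_partition[OF V] by blast
  qed
  then show ?thesis by (intro exI[of _ "max n0 1"]) blast
qed

end
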